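(* Let $\epsilon = \epsilon(x)$ be a fixed real-valued function tending to $0$ as $x\to\infty$. Suppose that $\mathcal{A}$ is a set of at most $x^{1/2+\epsilon(x)}$ positive integers. Then, as $x\to\infty$, $$\#\{n\le x : s(n)\in\mathcal{A}\} = o_\epsilon(x),$$ uniformly in the choice of $\mathcal{A}$. That is, for every $\delta>0$ there is a number $x_0$, depending only on $\delta$ and the function $\epsilon(\cdot)$, such that for every $x\ge x_0$ and every set $\mathcal{A}$ of positive integers with $\#\mathcal{A}\le x^{1/2+\epsilon(x)}$, one has $\#\{n\le x : s(n)\in\mathcal{A}\}\le \delta x$.
   Context: Here $n$ runs over positive integers. $\sigma(n)$ denotes the sum of all positive divisors of $n$, and $s(n)=\sigma(n)-n=\sum_{d\mid n,\ d<n} d$ is the sum of the proper divisors of $n$. The set $\mathcal{A}$ is allowed to depend on $x$. *)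

theory Defs
  imports Complex_Main
begin

definition divisor_sigma :: "nat \<Rightarrow> nat" where
  "divisor_sigma n = (\<Sum>d | d dvd n. d)"

text \<open>The subtraction is on the natural numbers; it does not truncate for positive \<open>n\<close>,
  as the lemma \<open>aliquot_sum_eq\<close> below shows.\<close>

definition aliquot_sum :: "nat \<Rightarrow> nat" where
  "aliquot_sum n = divisor_sigma n - n"

lemma aliquot_sum_eq:
  assumes "n > 0"
  shows "aliquot_sum n = (\<Sum>d | d dvd n \<and> d < n. d)"
proof -
  have eq: "{d. d dvd n} = insert n {d. d dvd n \<and> d < n}"
    using assms by (auto dest: dvd_imp_le)
  have "finite {d. d dvd n \<and> d < n}"
    by simp
  then have "divisor_sigma n = n + (\<Sum>d | d dvd n \<and> d < n. d)"
    unfolding divisor_sigma_def eq by (subst sum.insert) auto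
  then show ?thesis
    by (simp add: aliquot_sum_def)
qed

end

theory Submission
  imports Defs "HOL-Computational_Algebra.Primes" "HOL-Analysis.Harmonic_Numbers"
    "HOL-Real_Asymp.Real_Asymp"
begin

text \<open>Let \<open>X\<^sub>1 = x\<^sup>1\<^sup>/\<^sup>2\<^sup>-\<^sup>\<eta>\<close> and \<open>X\<^sub>2 = x\<^sup>1\<^sup>/\<^sup>2\<^sup>+\<^sup>\<eta>\<close>. Multiply the primes of \<open>n\<close> together in increasing order,
  and let \<open>d\<close> be the last partial product that is at most \<open>X\<^sub>1\<close>. For all but a small proportion of
  \<open>n \<le> x\<close>, the next prime is larger than a fixed power of \<open>x\<close>, divides \<open>n\<close> only once, and carries the product
  beyond \<open>X\<^sub>2\<close>; moreover \<open>n\<close> has a prime factor below a constant \<open>z\<close>. Then \<open>n = d m\<close> with \<open>d \<le> X\<^sub>1\<close>, and all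
  primes of \<open>m\<close> exceed \<open>X\<^sub>2 / d\<close>, so that \<open>s(m)\<close> is small. Given \<open>a\<close> and \<open>d\<close>, the equation
  \<open>a = s(d) m + \<sigma>(d) s(m)\<close> puts \<open>m\<close> into an interval of length \<open>x\<^sup>o\<^sup>(\<^sup>1\<^sup>) X\<^sub>1\<close>, and it also fixes \<open>m\<close> modulo
  \<open>\<sigma>(d) / gcd(d, \<sigma>(d))\<close>. Summing over \<open>d\<close> shows that \<open>s(n) = a\<close> has at most \<open>x\<^sup>o\<^sup>(\<^sup>1\<^sup>) X\<^sub>1\<close> such solutions, which beats
  the \<open>x\<^sup>1\<^sup>/\<^sup>2\<^sup>+\<^sup>o\<^sup>(\<^sup>1\<^sup>)\<close> choices of \<open>a\<close>.\<close>

section \<open>Chebyshev bounds for primes\<close>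

lemma prod_distinct_primes_dvd:
  fixes N :: nat
  assumes "finite S" "\<And>p. p \<in> S \<Longrightarrow> prime p \<and> p dvd N"
  shows "\<Prod>S dvd N"
  using assms
proof (induction S rule: finite_induct)
  case (insert p S)
  have "coprime p (\<Prod>S)"
    by (rule prod_coprime_right) (use insert in \<open>auto intro: primes_coprime\<close>)
  then show ?case
    using insert by (auto intro: divides_mult)
qed simp

text \<open>Erdos's induction: an even n > 2 is not prime, so n - 1 has the same primorial; for n =
  2m + 1 the primes in (m + 1, n] all divide the binomial coefficient (n choose m), which is at most
  4^m.\<close>

lemma primorial_le_4_power: "\<Prod>{p::nat. prime p \<and> p \<le> n} \<le> 4 ^ n"
proof (induction n rule: less_induct)
  case (less n)
  show ?case
  proof (cases "n \<le> 2")
    case True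
    then have "{p. prime p \<and> p \<le> n} \<subseteq> {2}"
      by (auto intro: le_antisym prime_ge_2_nat)
    then consider "{p. prime p \<and> p \<le> n} = {}" | "{p. prime p \<and> p \<le> n} = {2}"
      by (meson subset_singletonD)
    then show ?thesis
    proof cases
      case 1
      show ?thesis unfolding 1 by simp
    next
      case 2
      then have "n \<ge> 2" by blast
      then have "(4::nat) ^ 2 \<le> 4 ^ n" by (intro power_increasing) auto
      then show ?thesis unfolding 2 by simp
    qed
  next
    case n: False
    show ?thesis
    proof (cases "even n")
      case True
      then have "\<not> prime n" using n by (metis nat_neq_iff not_le prime_odd_nat)
      then have "{p. prime p \<and> p \<le> n} = {p. prime p \<and> p \<le> n - 1}"
        using le_eq_less_or_eq by fastforce
      then have "\<Prod>{p. prime p \<and> p \<le> n} \<le> 4 ^ (n - 1)"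
        using less.IH[of "n - 1"] n by auto
      also have "\<dots> \<le> 4 ^ n" by (rule power_increasing) auto
      finally show ?thesis .
    next
      case False
      then obtain m where m: "n = 2 * m + 1" by (elim oddE)
      with n have "m \<ge> 1" by auto
      let ?P = "{p. prime p \<and> p \<le> m + 1}" and ?Q = "{p. prime p \<and> m + 1 < p \<and> p \<le> n}"
      let ?C = "(2 * m + 1) choose m"
      have fin: "finite ?Q" by simp
      have "p dvd ?C" if "p \<in> ?Q" for p
      proof -
        have "fact m * fact (2 * m + 1 - m) * ?C = (fact (2 * m + 1) :: nat)"
          by (rule binomial_fact_lemma) simp
        then have "p dvd fact m * fact (m + 1) * ?C"
          using that m prime_dvd_fact_iff[of p n] by (simp add: mult.commute)
        then show ?thesis
          using that prime_dvd_fact_iff[of p m] prime_dvd_fact_iff[of p "m + 1"]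
          by (auto simp del: fact_Suc simp: prime_dvd_mult_iff)
      qed
      then have "\<Prod>?Q dvd ?C"
        using fin by (intro prod_distinct_primes_dvd) auto
      then have "\<Prod>?Q \<le> ?C" by (rule dvd_imp_le) simp
      \<comment> \<open>By symmetry the lower half of row 2m + 1 sums to half of 2^(2m + 1).\<close>
      also have "?C \<le> (\<Sum>k\<le>m. (2 * m + 1 choose k))"
        by (rule member_le_sum) auto
      also have "\<dots> = 4 ^ m" using binomial_r_part_sum[of m] by (simp add: power_mult)
      finally have Q: "\<Prod>?Q \<le> 4 ^ m" .
      have "{p. prime p \<and> p \<le> n} = ?P \<union> ?Q" using m by auto
      then have "\<Prod>{p. prime p \<and> p \<le> n} = \<Prod>?P * \<Prod>?Q"
        by (simp only:) (rule prod.union_disjoint, auto)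
      also have "\<dots> \<le> 4 ^ (m + 1) * 4 ^ m"
        using less.IH[of "m + 1"] m \<open>m \<ge> 1\<close> Q by (intro mult_mono) auto
      also have "\<dots> = 4 ^ n" by (simp add: m power_add mult_2)
      finally show ?thesis .
    qed
  qed
qed

text \<open>Chebyshev's bound for theta(t), obtained by taking logarithms in
  \<open>primorial_le_4_power\<close> at the floor of t.\<close>

lemma sum_ln_primes_le:
  fixes t :: real
  assumes "t \<ge> 0"
  shows "(\<Sum>p | prime p \<and> real p \<le> t. ln (real p)) \<le> ln 4 * t"
proof -
  let ?n = "nat \<lfloor>t\<rfloor>"
  have eq: "{p. prime p \<and> real p \<le> t} = {p. prime p \<and> p \<le> ?n}"
    using assms by (auto simp: le_nat_floor) linarith
  have "(\<Sum>p | prime p \<and> p \<le> ?n. ln (real p)) = ln (\<Prod>p | prime p \<and> p \<le> ?n. real p)"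
    by (rule ln_prod[symmetric]) (auto dest: prime_gt_0_nat)
  also have "(\<Prod>p | prime p \<and> p \<le> ?n. real p) = real (\<Prod>{p. prime p \<and> p \<le> ?n})"
    by simp
  also have "ln (real (\<Prod>{p. prime p \<and> p \<le> ?n})) \<le> ln (real (4 ^ ?n))"
  proof (subst ln_le_cancel_iff)
    show "real (\<Prod>{p. prime p \<and> p \<le> ?n}) \<le> real (4 ^ ?n)"
      using primorial_le_4_power by (simp only: of_nat_le_iff)
    show "0 < real (\<Prod>{p. prime p \<and> p \<le> ?n})"
      by (auto simp only: of_nat_0_less_iff intro!: prod_pos dest: prime_gt_0_nat)
  qed auto
  also have "\<dots> = ln 4 * ?n" by (simp add: ln_realpow)
  also have "\<dots> \<le> ln 4 * t" using assms by (intro mult_left_mono) auto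
  finally show ?thesis unfolding eq .
qed

lemma finite_nats_real_le [simp]: "finite {n::nat. P n \<and> real n \<le> t}"
  by (rule finite_subset[of _ "{..nat \<lfloor>t\<rfloor>}"]) (auto simp: le_nat_floor)

text \<open>Each prime counted contributes at least ln y to theta(t). The constant 2 is ln 4 rounded
  up.\<close>

lemma card_primes_between_le:
  fixes y t :: real
  assumes "y > 1" "t \<ge> 0"
  shows "real (card {p. prime p \<and> y < real p \<and> real p \<le> t}) * ln y \<le> 2 * t"
proof -
  let ?P = "{p. prime p \<and> y < real p \<and> real p \<le> t}"
  have "real (card ?P) * ln y = (\<Sum>p\<in>?P. ln y)" by simp
  also have "\<dots> \<le> (\<Sum>p\<in>?P. ln (real p))"
    using assms by (intro sum_mono) auto
  also have "\<dots> \<le> (\<Sum>p | prime p \<and> real p \<le> t. ln (real p))"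
    by (intro sum_mono2) (auto dest: prime_gt_0_nat)
  also have "\<dots> \<le> ln 4 * t" using assms by (intro sum_ln_primes_le)
  also have "\<dots> \<le> 2 * t"
  proof (rule mult_right_mono)
    have "ln (4::real) = 2 * ln 2" using ln_realpow[of "2::real" 2] by simp
    then show "ln (4::real) \<le> 2" using ln_2_less_1 by linarith
  qed fact
  finally show ?thesis .
qed

text \<open>Each doubling costs a constant: on (v, 2v] the weight ln p / p is below ln p / v, and
  Chebyshev's bound at 2v cancels the v.\<close>

lemma sum_ln_over_primes_dyadic:
  fixes u :: real
  assumes "u > 0"
  shows "(\<Sum>p | prime p \<and> u < real p \<and> real p \<le> u * 2 ^ k. ln (real p) / real p) \<le> k * (2 * ln 4)"
proof (induction k)
  case 0
  have "{p. prime p \<and> u < real p \<and> real p \<le> u * 2 ^ 0} = {}" by auto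
  then show ?case by (simp only: sum.empty)
next
  case (Suc k)
  let ?f = "\<lambda>p. ln (real p) / real p"
  let ?v = "u * 2 ^ k"
  let ?Q = "{p. prime p \<and> ?v < real p \<and> real p \<le> 2 * ?v}"
  have v: "?v > 0" "u \<le> ?v" using assms by auto
  have "{p. prime p \<and> u < real p \<and> real p \<le> u * 2 ^ Suc k} =
      {p. prime p \<and> u < real p \<and> real p \<le> ?v} \<union> ?Q"
    using v by auto
  then have "(\<Sum>p | prime p \<and> u < real p \<and> real p \<le> u * 2 ^ Suc k. ?f p) \<le>
      (\<Sum>p | prime p \<and> u < real p \<and> real p \<le> ?v. ?f p) + sum ?f ?Q"
    by (simp only:) (intro eq_refl sum.union_disjoint, auto)
  moreover have "sum ?f ?Q \<le> 2 * ln 4"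
  proof -
    have "sum ?f ?Q \<le> (\<Sum>p\<in>?Q. ln (real p) / ?v)"
      using v by (intro sum_mono divide_left_mono) (auto dest: prime_gt_0_nat)
    also have "\<dots> = (\<Sum>p\<in>?Q. ln (real p)) / ?v" by (simp only: sum_divide_distrib)
    also have "\<dots> \<le> (ln 4 * (2 * ?v)) / ?v"
    proof (rule divide_right_mono)
      have "(\<Sum>p\<in>?Q. ln (real p)) \<le> (\<Sum>p | prime p \<and> real p \<le> 2 * ?v. ln (real p))"
        by (intro sum_mono2) (auto dest: prime_gt_0_nat)
      also have "\<dots> \<le> ln 4 * (2 * ?v)" using v by (intro sum_ln_primes_le) auto
      finally show "(\<Sum>p\<in>?Q. ln (real p)) \<le> ln 4 * (2 * ?v)" .
    qed (use v in simp)
    also have "\<dots> = 2 * ln 4" using assms by simp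
    finally show ?thesis .
  qed
  ultimately show ?case using Suc by (simp add: algebra_simps)
qed

text \<open>The upper half of Mertens' first theorem, on an interval. At most log2(v / u) + 1 dyadic
  blocks cover (u, v]; the extra block gives the additive 4.\<close>

lemma sum_ln_over_primes_le:
  fixes u v :: real
  assumes "0 < u" "u \<le> v"
  shows "(\<Sum>p | prime p \<and> u < real p \<and> real p \<le> v. ln (real p) / real p) \<le> 4 * ln (v / u) + 4"
proof -
  define k where "k = nat \<lceil>log 2 (v / u)\<rceil>"
  have pos: "log 2 (v / u) \<ge> 0" using assms by simp
  then have k: "log 2 (v / u) \<le> k" "real k \<le> log 2 (v / u) + 1"
    unfolding k_def by linarith+
  have "v / u = 2 powr log 2 (v / u)" using assms by simp
  also have "\<dots> \<le> 2 powr real k" using k by (intro powr_mono) auto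
  finally have "v \<le> u * 2 ^ k" using assms by (simp add: powr_realpow field_simps)
  then have "(\<Sum>p | prime p \<and> u < real p \<and> real p \<le> v. ln (real p) / real p) \<le>
      (\<Sum>p | prime p \<and> u < real p \<and> real p \<le> u * 2 ^ k. ln (real p) / real p)"
    by (intro sum_mono2) (auto dest: prime_gt_0_nat)
  also have "\<dots> \<le> k * (2 * ln 4)" by (rule sum_ln_over_primes_dyadic) fact
  also have "\<dots> = k * (4 * ln 2)" using ln_realpow[of "2::real" 2] by simp
  also have "\<dots> \<le> (log 2 (v / u) + 1) * (4 * ln 2)" using k by (intro mult_right_mono) auto
  also have "\<dots> = 4 * ln (v / u) + 4 * ln 2" by (simp add: log_def field_simps)
  also have "\<dots> \<le> 4 * ln (v / u) + 4" using ln_2_less_1 by simp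
  finally show ?thesis .
qed

section \<open>Multiples, square divisors and rough numbers\<close>

lemma harm_le_1_ln: "n \<ge> 1 \<Longrightarrow> (harm n :: real) \<le> 1 + ln (real n)"
proof (induction n rule: nat_induct_at_least)
  case base
  show ?case by (simp add: harm_def)
next
  case (Suc n)
  have "ln (real n / real (Suc n)) \<le> real n / real (Suc n) - 1"
    using Suc by (intro ln_le_minus_one) auto
  also have "\<dots> = - inverse (real (Suc n))" by (simp add: field_simps)
  finally show ?case using Suc by (simp add: harm_Suc ln_div del: of_nat_Suc)
qed

lemma sum_inverse_nats_le:
  fixes x :: real
  assumes "x \<ge> 1"
  shows "(\<Sum>k | 0 < k \<and> real k \<le> x. 1 / real k) \<le> 1 + ln x"
proof -
  let ?n = "nat \<lfloor>x\<rfloor>"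
  have eq: "{k. 0 < k \<and> real k \<le> x} = {1..?n}"
    using assms by (auto simp: le_nat_floor) linarith
  have "?n \<ge> 1" "real ?n \<le> x" using assms by linarith+
  then have "(harm ?n :: real) \<le> 1 + ln x"
    using harm_le_1_ln[of ?n] ln_mono[of "real ?n" x] by linarith
  then show ?thesis unfolding eq by (simp add: harm_def inverse_eq_divide)
qed

lemma card_multiples_le:
  fixes x :: real
  assumes "x \<ge> 0" "k > 0"
  shows "real (card {n. 0 < n \<and> real n \<le> x \<and> k dvd n}) \<le> x / real k"
proof -
  have "{n. 0 < n \<and> real n \<le> x \<and> k dvd n} \<subseteq> (\<lambda>j. k * j) ` {1..nat \<lfloor>x / k\<rfloor>}"
    using assms by (auto simp: dvd_def image_iff le_nat_floor field_simps)
  then have "card {n. 0 < n \<and> real n \<le> x \<and> k dvd n} \<le> card ((\<lambda>j. k * j) ` {1..nat \<lfloor>x / k\<rfloor>})"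
    by (intro card_mono) auto
  also have "\<dots> \<le> nat \<lfloor>x / k\<rfloor>" using card_image_le[of "{1..nat \<lfloor>x / k\<rfloor>}"] by auto
  finally have "real (card {n. 0 < n \<and> real n \<le> x \<and> k dvd n}) \<le> real (nat \<lfloor>x / k\<rfloor>)"
    by (simp only: of_nat_le_iff)
  also have "\<dots> \<le> x / k" using assms by simp
  finally show ?thesis .
qed

text \<open>Sum x / q^2 over all integers q > y. Replacing 1 / q^2 by 1 / ((q - 1) q) makes the sum
  telescope to at most x / \<open>K\<close>, and y >= 2 gives \<open>K\<close> >= y / 2.\<close>

lemma card_large_square_divisor_le:
  fixes x y :: real
  assumes "x \<ge> 0" "y \<ge> 2"
  shows "real (card {n. 0 < n \<and> real n \<le> x \<and> (\<exists>q. y < real q \<and> q\<^sup>2 dvd n)}) \<le> 2 * x / y"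
proof -
  define N where "N = nat \<lfloor>x\<rfloor>"
  define K where "K = nat \<lfloor>y\<rfloor>"
  have K: "K \<ge> 2" "real K \<ge> y / 2" "real K \<le> y" using assms unfolding K_def by linarith+
  let ?B = "{n. 0 < n \<and> real n \<le> x \<and> (\<exists>q. y < real q \<and> q\<^sup>2 dvd n)}"
  \<comment> \<open>The end point \<open>max K N\<close> covers every q <= n <= \<open>N\<close> and
    keeps the telescoping valid when \<open>N\<close> < \<open>K\<close>.\<close>
  have "?B \<subseteq> (\<Union>q\<in>{K<..max K N}. {n. 0 < n \<and> real n \<le> x \<and> q\<^sup>2 dvd n})"
  proof safe
    fix n q :: nat assume n: "0 < n" "real n \<le> x" "y < real q" "q\<^sup>2 dvd n"
    then have "q dvd n" by (metis dvd_trans power2_eq_square dvd_triv_left)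
    then have "q \<le> n" using n by (intro dvd_imp_le)
    moreover have "n \<le> N" using n by (simp add: N_def le_nat_floor)
    ultimately show "n \<in> (\<Union>q\<in>{K<..max K N}. {n. 0 < n \<and> real n \<le> x \<and> q\<^sup>2 dvd n})"
      using n K by (intro UN_I[of q]) auto
  qed
  then have "card ?B \<le> card (\<Union>q\<in>{K<..max K N}. {n. 0 < n \<and> real n \<le> x \<and> q\<^sup>2 dvd n})"
    by (intro card_mono) (auto intro: finite_subset[OF _ finite_nats_real_le[of "\<lambda>_. True" x]])
  also have "\<dots> \<le> (\<Sum>q\<in>{K<..max K N}. card {n. 0 < n \<and> real n \<le> x \<and> q\<^sup>2 dvd n})"
    by (rule card_UN_le) simp
  finally have "real (card ?B) \<le> (\<Sum>q\<in>{K<..max K N}. real (card {n. 0 < n \<and> real n \<le> x \<and> q\<^sup>2 dvd n}))"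
    by (simp only: of_nat_le_iff flip: of_nat_sum)
  also have "\<dots> \<le> (\<Sum>q\<in>{K<..max K N}. x * (1 / real (q - 1) - 1 / real q))"
  proof (rule sum_mono)
    fix q assume q: "q \<in> {K<..max K N}"
    then have "q \<ge> 2" using K by auto
    have "real (card {n. 0 < n \<and> real n \<le> x \<and> q\<^sup>2 dvd n}) \<le> x / real (q\<^sup>2)"
      using assms \<open>q \<ge> 2\<close> by (intro card_multiples_le) auto
    also have "\<dots> = x * (1 / (real q * real q))" by (simp add: power2_eq_square)
    also have "\<dots> \<le> x * (1 / (real (q - 1) * real q))"
      using assms \<open>q \<ge> 2\<close> by (intro mult_left_mono divide_left_mono mult_right_mono) auto
    also have "1 / (real (q - 1) * real q) = 1 / real (q - 1) - 1 / real q"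
      using \<open>q \<ge> 2\<close> by (simp add: field_simps of_nat_diff)
    finally show "real (card {n. 0 < n \<and> real n \<le> x \<and> q\<^sup>2 dvd n}) \<le> x * (1 / real (q - 1) - 1 / real q)" .
  qed
  also have "\<dots> = x * (\<Sum>q\<in>{K<..max K N}. 1 / real (q - 1) - 1 / real q)"
    by (simp add: sum_distrib_left)
  also have "(\<Sum>q\<in>{K<..M}. 1 / real (q - 1) - 1 / real q) = 1 / K - 1 / M" if "M \<ge> K" for M
    using that
  proof (induction M rule: dec_induct)
    case (step M)
    have "{K<..Suc M} = insert (Suc M) {K<..M}" using step by auto
    then show ?case using step by (simp del: of_nat_Suc)
  qed simp
  then have "x * (\<Sum>q\<in>{K<..max K N}. 1 / real (q - 1) - 1 / real q) \<le> x * (1 / K)"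
    using assms by (intro mult_left_mono) auto
  also have "\<dots> \<le> x * (1 / (y / 2))"
    using K assms by (intro mult_left_mono divide_left_mono) auto
  finally show ?thesis by (simp add: mult.commute)
qed

section \<open>Numbers without small prime factors\<close>

definition rough_upto :: "nat \<Rightarrow> nat \<Rightarrow> bool" where
  "rough_upto z n \<longleftrightarrow> (\<forall>p. prime p \<and> p \<le> z \<longrightarrow> \<not> p dvd n)"

lemma rough_upto_coprime:
  assumes "rough_upto z n" "0 < k" "k \<le> z"
  shows "coprime k n"
proof (rule ccontr)
  assume "\<not> coprime k n"
  then obtain p where p: "prime p" "p dvd k" "p dvd n"
    using prime_factor_nat[of "gcd k n"] by (auto simp: coprime_iff_gcd_eq_1)
  then have "p \<le> z" using assms dvd_imp_le[of p k] by linarith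
  then show False using p assms by (auto simp: rough_upto_def)
qed

text \<open>The primes up to z are exactly those dividing z!, so roughness depends only on the
  residue modulo z!.\<close>

lemma rough_upto_add_fact: "rough_upto z (j * fact z + r) \<longleftrightarrow> rough_upto z r"
  unfolding rough_upto_def
  by (metis dvd_add_right_iff dvd_mult prime_dvd_fact_iff)

text \<open>With \<open>\<phi>\<close> rough residues modulo \<open>z!\<close>, the disjoint dilates \<open>k R(x/k)\<close>, \<open>k \<le> z\<close>, of the sets
  \<open>R(x)\<close> of rough numbers give \<open>\<phi> / z! \<le> 1 / H\<^sub>z\<close> in the limit.\<close>

lemma card_rough_upto_le:
  fixes x :: real
  assumes "z \<ge> 2" "x \<ge> 0"
  shows "real (card {n. rough_upto z n \<and> real n \<le> x}) \<le> x / harm z + (z / harm z + 1) * fact z"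
proof -
  define M :: nat where "M = fact z"
  have M: "M > 0" by (simp add: M_def)
  define \<Phi> where "\<Phi> = {r. r < M \<and> rough_upto z r}"
  define \<phi> where "\<phi> = card \<Phi>"
  define R where "R = (\<lambda>t::real. {n. rough_upto z n \<and> real n \<le> t})"
  have fin\<Phi>: "finite \<Phi>" by (simp add: \<Phi>_def)
  have "\<phi> \<le> card {..<M}" unfolding \<phi>_def by (rule card_mono) (auto simp: \<Phi>_def)
  then have \<phi>M: "\<phi> \<le> M" by simp
  have finR: "finite (R t)" for t by (simp add: R_def)
  have H: "harm z > (0::real)" using assms by simp
  \<comment> \<open>Every prime divides 0, so 0 is not rough once z >= 2.\<close>
  have pos: "n > 0" if "rough_upto z n" for n
    using that assms two_is_prime_nat by (cases n) (auto simp: rough_upto_def)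

  \<comment> \<open>Cut [0, t] into blocks of length \<open>M\<close>, each holding at most
    \<open>\<phi>\<close> rough numbers; the incomplete last block accounts for the + 1. The lower
    bound counts complete blocks only.\<close>
  have upper: "real (card (R t)) \<le> (t / M + 1) * \<phi>" if "t \<ge> 0" for t
  proof -
    let ?J = "{..nat \<lfloor>t / M\<rfloor>}"
    have "R t \<subseteq> (\<lambda>(j, r). j * M + r) ` (?J \<times> \<Phi>)"
    proof
      fix n assume n: "n \<in> R t"
      have eq: "n = n div M * M + n mod M" by simp
      have "real (n div M) \<le> real n / real M" using M by (simp add: pos_le_divide_eq flip: of_nat_mult)
      also have "\<dots> \<le> t / M" using n by (auto simp: R_def divide_right_mono)
      finally have "n div M \<in> ?J" by (simp add: le_nat_floor)
      moreover have "n mod M \<in> \<Phi>"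
        using n M rough_upto_add_fact[of z "n div M" "n mod M"] by (auto simp: \<Phi>_def R_def M_def)
      ultimately show "n \<in> (\<lambda>(j, r). j * M + r) ` (?J \<times> \<Phi>)"
        using eq by (intro image_eqI[of _ _ "(n div M, n mod M)"]) auto
    qed
    then have "card (R t) \<le> card ((\<lambda>(j, r). j * M + r) ` (?J \<times> \<Phi>))"
      using fin\<Phi> by (intro card_mono) auto
    also have "\<dots> \<le> card (?J \<times> \<Phi>)" using fin\<Phi> by (intro card_image_le) auto
    also have "\<dots> = (nat \<lfloor>t / M\<rfloor> + 1) * \<phi>" by (simp add: card_cartesian_product \<phi>_def)
    finally have "real (card (R t)) \<le> real ((nat \<lfloor>t / M\<rfloor> + 1) * \<phi>)" by (simp only: of_nat_le_iff)
    also have "\<dots> = (real (nat \<lfloor>t / M\<rfloor>) + 1) * \<phi>" by (simp add: algebra_simps)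
    also have "\<dots> \<le> (t / M + 1) * \<phi>" using that by (intro mult_right_mono) auto
    finally show ?thesis .
  qed

  have lower: "(t / M - 1) * \<phi> \<le> real (card (R t))" if "t \<ge> 0" for t
  proof -
    let ?J = "{..<nat \<lfloor>t / M\<rfloor>}"
    have inj: "inj_on (\<lambda>(j, r). j * M + r) (?J \<times> \<Phi>)"
    proof (rule inj_onI, clarsimp)
      fix j r j' r' assume h: "r \<in> \<Phi>" "r' \<in> \<Phi>" "j * M + r = j' * M + r'"
      have "(i * M + s) mod M = s \<and> (i * M + s) div M = i" if "s \<in> \<Phi>" for i s
        using that by (auto simp: \<Phi>_def)
      then show "j = j' \<and> r = r'" using h by metis
    qed
    have sub: "(\<lambda>(j, r). j * M + r) ` (?J \<times> \<Phi>) \<subseteq> R t"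
    proof safe
      fix j r assume h: "j < nat \<lfloor>t / M\<rfloor>" "r \<in> \<Phi>"
      have "j * M + r \<le> (j + 1) * M" using h by (auto simp: \<Phi>_def)
      also have "\<dots> \<le> nat \<lfloor>t / M\<rfloor> * M" using h by (intro mult_right_mono) auto
      finally have "real (j * M + r) \<le> real (nat \<lfloor>t / M\<rfloor> * M)" by (simp only: of_nat_le_iff)
      also have "\<dots> = real (nat \<lfloor>t / M\<rfloor>) * M" by simp
      also have "\<dots> \<le> t / M * M" using that by (intro mult_right_mono) auto
      also have "\<dots> = t" using M by simp
      finally show "j * M + r \<in> R t"
        using h rough_upto_add_fact[of z j r] by (auto simp: R_def \<Phi>_def M_def)
    qed
    have "t / M - 1 \<le> real (nat \<lfloor>t / M\<rfloor>)" by linarith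
    then have "(t / M - 1) * \<phi> \<le> real (nat \<lfloor>t / M\<rfloor>) * \<phi>" by (intro mult_right_mono) auto
    also have "\<dots> = real (card ((\<lambda>(j, r). j * M + r) ` (?J \<times> \<Phi>)))"
      by (simp add: card_image[OF inj] card_cartesian_product \<phi>_def)
    also have "\<dots> \<le> real (card (R t))" using sub finR by (simp add: card_mono)
    finally show ?thesis .
  qed

  have dilates: "(\<Sum>k\<in>{1..z}. real (card (R (x / k)))) \<le> x"
  proof -
    have "(\<Sum>k\<in>{1..z}. card (R (x / k))) = (\<Sum>k\<in>{1..z}. card ((\<lambda>n. k * n) ` R (x / k)))"
      by (intro sum.cong refl card_image[symmetric]) (auto intro: inj_onI)
    also have "\<dots> = card (\<Union>k\<in>{1..z}. (\<lambda>n. k * n) ` R (x / k))"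
    proof (rule card_UN_disjoint[symmetric])
      show "\<forall>i\<in>{1..z}. \<forall>j\<in>{1..z}. i \<noteq> j \<longrightarrow>
          (\<lambda>n. i * n) ` R (x / i) \<inter> (\<lambda>n. j * n) ` R (x / j) = {}"
      proof (intro ballI impI, rule ccontr)
        fix i j assume ij: "i \<in> {1..z}" "j \<in> {1..z}" "i \<noteq> j"
          and "(\<lambda>n. i * n) ` R (x / i) \<inter> (\<lambda>n. j * n) ` R (x / j) \<noteq> {}"
        then obtain m n where mn: "rough_upto z m" "rough_upto z n" "i * m = j * n"
          by (auto simp: R_def)
        \<comment> \<open>A common value i m = j n with m and n rough forces i to divide j and j to
          divide i.\<close>
        have "coprime i n" "coprime j m" using mn ij by (auto intro: rough_upto_coprime)
        then have "i dvd j" "j dvd i"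
          using mn(3) by (metis coprime_dvd_mult_left_iff dvd_triv_left)+
        then show False using ij dvd_antisym by blast
      qed
    qed (use finR in auto)
    also have "\<dots> \<le> card {1..nat \<lfloor>x\<rfloor>}"
    proof (rule card_mono)
      show "(\<Union>k\<in>{1..z}. (\<lambda>n. k * n) ` R (x / k)) \<subseteq> {1..nat \<lfloor>x\<rfloor>}"
        using pos by (auto simp: R_def field_simps intro!: le_nat_floor Suc_leI)
    qed simp
    also have "\<dots> = nat \<lfloor>x\<rfloor>" by simp
    finally have "real (\<Sum>k\<in>{1..z}. card (R (x / k))) \<le> real (nat \<lfloor>x\<rfloor>)" by (simp only: of_nat_le_iff)
    also have "\<dots> \<le> x" using assms by simp
    finally show ?thesis by simp
  qed

  \<comment> \<open>Inserting the lower count at t = x / k turns the sum of 1 / k into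
    \<open>harm z\<close> and bounds x / \<open>M\<close> * \<open>\<phi>\<close>; the upper count
    at t = x then finishes.\<close>
  have "(\<Sum>k\<in>{1..z}. (x / k / M - 1) * \<phi>) \<le> (\<Sum>k\<in>{1..z}. real (card (R (x / k))))"
    using assms by (intro sum_mono lower) auto
  also have "(\<Sum>k\<in>{1..z}. (x / k / M - 1) * \<phi>) = (x / M * harm z - z) * \<phi>"
    by (simp add: harm_def sum_distrib_left sum_distrib_right sum_subtractf field_simps)
  finally have "(x / M * harm z - z) * \<phi> \<le> x" using dilates by linarith
  then have "(x / M * \<phi>) * harm z \<le> x + z * \<phi>" by (simp add: algebra_simps)
  also have "\<dots> \<le> x + z * M" using \<phi>M by (simp add: mult_left_mono flip: of_nat_mult)
  finally have "x / M * \<phi> \<le> (x + z * M) / harm z" using H by (simp add: pos_le_divide_eq)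
  then have "(x / M + 1) * \<phi> \<le> (x + z * M) / harm z + M" using \<phi>M by (simp add: algebra_simps)
  also have "\<dots> = x / harm z + (z / harm z + 1) * M" by (simp add: add_divide_distrib algebra_simps)
  finally show ?thesis using upper[OF assms(2)] unfolding R_def M_def by simp
qed

section \<open>The divisor bound\<close>

lemma card_divisors_mult_le:
  fixes a b :: nat
  assumes "a > 0" "b > 0"
  shows "card {d. d dvd a * b} \<le> card {d. d dvd a} * card {d. d dvd b}"
proof -
  have "{d. d dvd a * b} \<subseteq> (\<lambda>(d, e). d * e) ` ({d. d dvd a} \<times> {d. d dvd b})"
  proof
    fix d assume "d \<in> {d. d dvd a * b}"
    then obtain b' c' where "d = b' * c'" "b' dvd a" "c' dvd b"
      using division_decomp[of d a b] by auto
    then show "d \<in> (\<lambda>(d, e). d * e) ` ({d. d dvd a} \<times> {d. d dvd b})"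
      by (intro image_eqI[of _ _ "(b', c')"]) auto
  qed
  then have "card {d. d dvd a * b} \<le> card ((\<lambda>(d, e). d * e) ` ({d. d dvd a} \<times> {d. d dvd b}))"
    using assms by (intro card_mono) auto
  also have "\<dots> \<le> card ({d. d dvd a} \<times> {d. d dvd b})"
    using assms by (intro card_image_le) auto
  finally show ?thesis by (simp add: card_cartesian_product)
qed

lemma card_divisors_prime_power_le:
  fixes p :: nat
  assumes "prime p"
  shows "card {d. d dvd p ^ k} \<le> k + 1"
proof -
  have "{d. d dvd p ^ k} \<subseteq> (\<lambda>i. p ^ i) ` {..k}"
    using assms by (auto simp: divides_primepow_nat)
  then have "card {d. d dvd p ^ k} \<le> card ((\<lambda>i. p ^ i) ` {..k})"
    by (intro card_mono) auto
  also have "\<dots> \<le> card {..k}" by (intro card_image_le) auto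
  finally show ?thesis by simp
qed

text \<open>A prime power contributes a factor \<open>k + 1\<close> to the number of divisors, which is at most
  \<open>p\<^sup>k\<^sup>e\<close> once \<open>p\<^sup>e \<ge> 2\<close>; the finitely many smaller primes go into the constant.\<close>

lemma card_divisors_le_powr:
  fixes e :: real
  assumes "e > 0"
  obtains C :: real where "C \<ge> 1" "\<And>n::nat. n > 0 \<Longrightarrow> real (card {d. d dvd n}) \<le> C * real n powr e"
proof -
  \<comment> \<open>\<open>B\<close> satisfies both \<open>B\<close> >= 1 and \<open>B\<close> e ln
    2 >= 1, so k + 1 <= \<open>B\<close> (1 + k e ln 2). From \<open>P\<close> onwards every p has
    p^e >= 2.\<close>
  define B where "B = 1 + 1 / (e * ln 2)"
  define P where "P = nat \<lceil>2 powr (1 / e)\<rceil>"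
  have B: "B \<ge> 1" using assms by (simp add: B_def)
  define c where "c = (\<lambda>p. if p < P then B else 1)"
  have c: "real (k + 1) \<le> c p * real (p ^ k) powr e" if "prime p" for p k :: nat
  proof (cases "p < P")
    case True
    have "1 + k * e * ln 2 \<le> exp (k * e * ln 2)" by (rule exp_ge_add_one_self)
    also have "\<dots> = (2 ^ k) powr e" by (simp add: powr_def ln_realpow ac_simps)
    also have "\<dots> \<le> real (p ^ k) powr e"
      using assms prime_ge_2_nat[OF that] by (intro powr_mono2) (auto intro: power_mono)
    finally have "B * (1 + k * e * ln 2) \<le> B * real (p ^ k) powr e" using B by (intro mult_left_mono) auto
    moreover have "real (k + 1) \<le> B * (1 + k * e * ln 2)"
      using assms by (simp add: B_def field_simps)
    ultimately show ?thesis using True by (simp add: c_def)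
  next
    case False
    then have "2 powr (1 / e) \<le> p" unfolding P_def by linarith
    then have "(2 powr (1 / e)) powr e \<le> p powr e" using assms by (intro powr_mono2) auto
    then have "2 \<le> real p powr e" using assms by (simp add: powr_powr)
    then have "2 ^ k \<le> (real p powr e) ^ k" by (intro power_mono) auto
    also have "\<dots> = real (p ^ k) powr e"
      using prime_gt_0_nat[OF that] by (simp add: powr_powr powr_realpow[symmetric] mult.commute)
    finally have "2 ^ k \<le> real (p ^ k) powr e" .
    moreover have "real (k + 1) \<le> real (2 ^ k)"
      using less_exp[of k] by (simp only: of_nat_le_iff)
    ultimately show ?thesis using False by (simp add: c_def)
  qed
  have main: "real (card {d. d dvd (\<Prod>p\<in>S. p ^ f p)}) \<le> (\<Prod>p\<in>S. c p) * real (\<Prod>p\<in>S. p ^ f p) powr e"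
    if "finite S" "\<And>p. p \<in> S \<Longrightarrow> prime p" for S :: "nat set" and f
    using that
  proof (induction S rule: finite_induct)
    case (insert p S)
    let ?m = "\<Prod>p\<in>S. p ^ f p"
    have p: "prime p" using insert by auto
    have "?m > 0" using insert by (auto intro!: prod_pos prime_gt_0_nat)
    then have "card {d. d dvd p ^ f p * ?m} \<le> card {d. d dvd p ^ f p} * card {d. d dvd ?m}"
      using prime_gt_0_nat[OF p] by (intro card_divisors_mult_le) auto
    then have "real (card {d. d dvd p ^ f p * ?m}) \<le> real (card {d. d dvd p ^ f p}) * real (card {d. d dvd ?m})"
      by (simp only: of_nat_le_iff flip: of_nat_mult)
    also have "\<dots> \<le> (c p * real (p ^ f p) powr e) * ((\<Prod>p\<in>S. c p) * real ?m powr e)"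
    proof (rule mult_mono)
      have "real (card {d. d dvd p ^ f p}) \<le> real (f p + 1)"
        using card_divisors_prime_power_le[OF p] by (simp only: of_nat_le_iff)
      also have "\<dots> \<le> c p * real (p ^ f p) powr e" by (rule c[OF p])
      finally show "real (card {d. d dvd p ^ f p}) \<le> c p * real (p ^ f p) powr e" .
      show "real (card {d. d dvd ?m}) \<le> (\<Prod>p\<in>S. c p) * real ?m powr e" using insert by auto
    qed (use B in \<open>auto simp: c_def\<close>)
    also have "\<dots> = (\<Prod>p\<in>insert p S. c p) * (real (p ^ f p) powr e * real ?m powr e)"
      using insert by simp
    also have "real (p ^ f p) powr e * real ?m powr e = real (\<Prod>p\<in>insert p S. p ^ f p) powr e"
      using insert by (simp add: powr_mult prod_nonneg)
    finally show ?case using insert by simp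
  qed simp
  have "real (card {d. d dvd n}) \<le> B ^ P * real n powr e" if "n > 0" for n :: nat
  proof -
    let ?S = "prime_factors n"
    have n: "n = (\<Prod>p\<in>?S. p ^ multiplicity p n)"
      using that by (simp add: prod_prime_factors)
    \<comment> \<open>At most \<open>P\<close> primes carry a factor other than 1, so the constant
      does not depend on n.\<close>
    have "(\<Prod>p\<in>?S. c p) = (\<Prod>p\<in>?S \<inter> {..<P}. c p)"
      by (rule prod.mono_neutral_right) (auto simp: c_def)
    also have "\<dots> = B ^ card (?S \<inter> {..<P})" by (simp add: c_def)
    also have "\<dots> \<le> B ^ P"
      using B card_mono[of "{..<P}" "?S \<inter> {..<P}"] by (intro power_increasing) auto
    finally have "(\<Prod>p\<in>?S. c p) \<le> B ^ P" .
    then show ?thesis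
      using main[of ?S "\<lambda>p. multiplicity p n"] unfolding n[symmetric]
      by (meson finite_set_mset in_prime_factors_imp_prime mult_right_mono order_trans powr_ge_zero)
  qed
  then show ?thesis using B that[of "B ^ P"] by simp
qed

section \<open>Smooth parts\<close>

text \<open>The product runs over all primes up to t, so raising t by one inserts at most one
  factor. As t grows, the values are the partial products of n over its primes in increasing order,
  repeated primes being taken together.\<close>

definition smooth_part :: "nat \<Rightarrow> nat \<Rightarrow> nat" where
  "smooth_part t n = (\<Prod>p | prime p \<and> p \<le> t. p ^ multiplicity p n)"

lemma smooth_part_pos [simp]: "smooth_part t n > 0"
  unfolding smooth_part_def by (auto intro!: prod_pos prime_gt_0_nat)

lemma smooth_part_mult:
  assumes "a > 0" "b > 0"
  shows "smooth_part t (a * b) = smooth_part t a * smooth_part t b"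
  unfolding smooth_part_def prod.distrib[symmetric]
  using assms by (intro prod.cong) (auto simp: prime_elem_multiplicity_mult_distrib power_add)

lemma smooth_part_eq_1:
  assumes "\<And>p. prime p \<Longrightarrow> p dvd n \<Longrightarrow> t < p"
  shows "smooth_part t n = 1"
  unfolding smooth_part_def
proof (rule prod.neutral, safe)
  fix p assume "prime p" "p \<le> t"
  then have "\<not> p dvd n" using assms[of p] by auto
  then show "p ^ multiplicity p n = 1" by (simp add: not_dvd_imp_multiplicity_0)
qed

lemma smooth_part_full:
  assumes "n > 0" "n \<le> t"
  shows "smooth_part t n = n"
proof -
  have "(\<Prod>p\<in>prime_factors n. p ^ multiplicity p n) = smooth_part t n"
    unfolding smooth_part_def
  proof (rule prod.mono_neutral_left)
    show "prime_factors n \<subseteq> {p. prime p \<and> p \<le> t}"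
      using assms by (auto simp: in_prime_factors_iff dest!: dvd_imp_le)
  qed (use assms in \<open>auto simp: in_prime_factors_iff not_dvd_imp_multiplicity_0\<close>)
  then show ?thesis using assms by (simp add: prod_prime_factors)
qed

lemma smooth_part_Suc:
  "smooth_part (Suc t) n = smooth_part t n * (if prime (Suc t) then Suc t ^ multiplicity (Suc t) n else 1)"
proof (cases "prime (Suc t)")
  case True
  then have "{p. prime p \<and> p \<le> Suc t} = insert (Suc t) {p. prime p \<and> p \<le> t}"
    by (auto simp: le_Suc_eq)
  then show ?thesis using True by (simp add: smooth_part_def mult.commute)
next
  case False
  then have "{p. prime p \<and> p \<le> Suc t} = {p. prime p \<and> p \<le> t}"
    by (auto simp: le_Suc_eq)
  then show ?thesis using False by (simp add: smooth_part_def)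
qed

lemma prime_dvd_smooth_part_iff:
  assumes "prime p" "n > 0"
  shows "p dvd smooth_part t n \<longleftrightarrow> p \<le> t \<and> p dvd n"
proof
  assume "p dvd smooth_part t n"
  then obtain q where q: "prime q" "q \<le> t" "p dvd q ^ multiplicity q n"
    using assms by (auto simp: smooth_part_def prime_dvd_prod_iff)
  then have "p = q" using assms prime_dvd_power primes_dvd_imp_eq by blast
  moreover have "multiplicity q n > 0"
    using q assms by (intro gr0I) (auto dest: prime_gt_1_nat)
  then have "q dvd n" by (rule contrapos_pp) (simp add: not_dvd_imp_multiplicity_0)
  ultimately show "p \<le> t \<and> p dvd n" using q by simp
next
  assume p: "p \<le> t \<and> p dvd n"
  then have "multiplicity p n > 0" using assms by (simp add: prime_multiplicity_gt_zero_iff)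
  then have "p dvd p ^ multiplicity p n" by simp
  also have "\<dots> dvd smooth_part t n"
    unfolding smooth_part_def using p assms by (intro dvd_prodI) auto
  finally show "p dvd smooth_part t n" .
qed

text \<open>The cofactor collects the prime powers with primes in (t, \<open>max n t\<close>]: this
  bound is at least n, so that all of n is recovered, and at least t, so that the range splits at
  t.\<close>

lemma smooth_part_decomp:
  assumes "n > 0"
  obtains m where "n = smooth_part t n * m" "m > 0" "coprime (smooth_part t n) m"
    "\<And>p. prime p \<Longrightarrow> p dvd m \<Longrightarrow> t < p"
proof -
  define m where "m = (\<Prod>p | prime p \<and> t < p \<and> p \<le> max n t. p ^ multiplicity p n)"
  have "{p. prime p \<and> p \<le> max n t} = {p. prime p \<and> p \<le> t} \<union> {p. prime p \<and> t < p \<and> p \<le> max n t}"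
    by auto
  then have "smooth_part (max n t) n = smooth_part t n * m"
    unfolding smooth_part_def m_def by (simp only:) (rule prod.union_disjoint, auto)
  then have n: "n = smooth_part t n * m" using assms smooth_part_full[of n "max n t"] by simp
  have big: "t < p" if "prime p" "p dvd m" for p
  proof -
    from that obtain q where "prime q" "t < q" "p dvd q ^ multiplicity q n"
      by (auto simp: m_def prime_dvd_prod_iff)
    then show ?thesis using that prime_dvd_power primes_dvd_imp_eq by blast
  qed
  have "coprime (smooth_part t n) m"
  proof (rule ccontr)
    assume "\<not> coprime (smooth_part t n) m"
    then obtain p where "prime p" "p dvd smooth_part t n" "p dvd m"
      using prime_factor_nat[of "gcd (smooth_part t n) m"] by (auto simp: coprime_iff_gcd_eq_1)
    then show False using big[of p] assms by (simp add: prime_dvd_smooth_part_iff)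
  qed
  moreover have "m > 0" using n assms by (intro gr0I) auto
  ultimately show ?thesis using n big that by blast
qed

text \<open>The multiplicity counts the e >= 1 with p^e dividing n. Exchanging the sums leaves the
  geometric series of x / p^e, whose ratio is at most 1/2.\<close>

lemma sum_multiplicity_le:
  fixes x :: real
  assumes "prime p" "x \<ge> 0"
  shows "(\<Sum>n | 0 < n \<and> real n \<le> x. real (multiplicity p n)) \<le> 2 * x / real p"
proof -
  define N where "N = nat \<lfloor>x\<rfloor>"
  define A where "A = {n. 0 < n \<and> real n \<le> x}"
  have p: "p \<ge> 2" using assms prime_ge_2_nat by auto
  have finA: "finite A" unfolding A_def by simp
  have "real (multiplicity p n) = (\<Sum>e\<in>{1..N}. if p ^ e dvd n then 1 else 0)" if "n \<in> A" for n
  proof -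
    have n: "n > 0" "n \<le> N" using that by (auto simp: A_def N_def le_nat_floor)
    have "{e \<in> {1..N}. p ^ e dvd n} = {1..multiplicity p n}"
    proof -
      \<comment> \<open>Exponents up to \<open>N\<close> suffice because e < 2^e <= p^e <=
        n.\<close>
      have "e \<le> N" if "e \<le> multiplicity p n" for e
      proof -
        have "e < 2 ^ e" by (rule less_exp)
        also have "(2::nat) ^ e \<le> p ^ e" using p by (rule power_mono) simp
        also have "p ^ e \<le> n" using that n multiplicity_dvd'[OF that] by (auto intro: dvd_imp_le)
        finally show ?thesis using n by simp
      qed
      moreover have "p ^ e dvd n \<longleftrightarrow> e \<le> multiplicity p n" for e
        using n p assms by (intro power_dvd_iff_le_multiplicity) auto
      ultimately show ?thesis by auto
    qed
    then have "card {e \<in> {1..N}. p ^ e dvd n} = multiplicity p n" by simp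
    moreover have "{1..N} \<inter> {e. p ^ e dvd n} = {e \<in> {1..N}. p ^ e dvd n}" by auto
    ultimately show ?thesis by (simp add: sum.If_cases)
  qed
  then have "(\<Sum>n\<in>A. real (multiplicity p n)) = (\<Sum>n\<in>A. \<Sum>e\<in>{1..N}. if p ^ e dvd n then 1 else 0)"
    by (intro sum.cong) auto
  also have "\<dots> = (\<Sum>e\<in>{1..N}. \<Sum>n\<in>A. if p ^ e dvd n then 1 else 0)" by (rule sum.swap)
  also have "\<dots> = (\<Sum>e\<in>{1..N}. real (card {n. 0 < n \<and> real n \<le> x \<and> p ^ e dvd n}))"
  proof (intro sum.cong refl)
    fix e
    have "A \<inter> {n. p ^ e dvd n} = {n. 0 < n \<and> real n \<le> x \<and> p ^ e dvd n}" by (auto simp: A_def)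
    then show "(\<Sum>n\<in>A. if p ^ e dvd n then 1 else 0) = real (card {n. 0 < n \<and> real n \<le> x \<and> p ^ e dvd n})"
      using finA by (simp add: sum.If_cases)
  qed
  also have "\<dots> \<le> (\<Sum>e\<in>{1..N}. x / real (p ^ e))"
    using assms p by (intro sum_mono card_multiples_le) auto
  also have "\<dots> = x * (\<Sum>e\<in>{1..N}. (1 / real p) ^ e)"
    by (simp add: sum_distrib_left power_divide)
  also have "\<dots> \<le> x * (2 * (1 / real p))"
  proof (rule mult_left_mono)
    define q where "q = 1 / real p"
    have q: "0 \<le> q" "q \<le> 1 / 2" using p by (auto simp: q_def field_simps)
    have geom: "(1 - q) * (\<Sum>e\<in>{1..K}. q ^ e) = q - q ^ Suc K" for K
    proof (induction K)
      case (Suc K)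
      have "(1 - q) * (\<Sum>e\<in>{1..Suc K}. q ^ e) = (1 - q) * (\<Sum>e\<in>{1..K}. q ^ e) + (1 - q) * q ^ Suc K"
        by (simp add: distrib_left)
      also have "\<dots> = q - q ^ Suc (Suc K)" unfolding Suc.IH by (simp add: algebra_simps)
      finally show ?case .
    qed simp
    define G where "G = (\<Sum>e\<in>{1..N}. q ^ e)"
    have "1 / 2 * G \<le> (1 - q) * G"
      using q unfolding G_def by (intro mult_right_mono sum_nonneg) auto
    also have "\<dots> \<le> q" using geom[of N] q unfolding G_def by simp
    finally show "(\<Sum>e\<in>{1..N}. (1 / real p) ^ e) \<le> 2 * (1 / real p)"
      unfolding q_def[symmetric] G_def by simp
  qed fact
  also have "\<dots> = 2 * x / real p" by simp
  finally show ?thesis unfolding A_def .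
qed

text \<open>Markov's inequality for the logarithm of the smooth part. Its total over n <= x is a sum
  over primes p <= y of ln p times the total multiplicity, hence at most 2x times a Mertens sum
  starting at 1.\<close>

lemma card_large_smooth_part_le:
  fixes x w y :: real
  assumes "x \<ge> 0" "w \<ge> 1" "y \<ge> 1"
  shows "real (card {n. 0 < n \<and> real n \<le> x \<and> w < real (smooth_part (nat \<lfloor>y\<rfloor>) n)}) * ln w
    \<le> 8 * x * (ln y + 1)"
proof -
  define A where "A = {n. 0 < n \<and> real n \<le> x}"
  define t where "t = nat \<lfloor>y\<rfloor>"
  define B where "B = {n. 0 < n \<and> real n \<le> x \<and> w < real (smooth_part t n)}"
  have finA: "finite A" unfolding A_def by simp
  have "{p. prime p \<and> p \<le> t} = {p. prime p \<and> 1 < real p \<and> real p \<le> y}"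
    using assms by (auto simp: t_def le_nat_floor dest: prime_gt_1_nat) linarith
  note P = this
  have ln_sp: "ln (real (smooth_part t n)) = (\<Sum>p | prime p \<and> p \<le> t. real (multiplicity p n) * ln (real p))" for n
  proof -
    have "ln (real (smooth_part t n)) = ln (\<Prod>p | prime p \<and> p \<le> t. real p ^ multiplicity p n)"
      by (simp add: smooth_part_def)
    also have "\<dots> = (\<Sum>p | prime p \<and> p \<le> t. ln (real p ^ multiplicity p n))"
      by (rule ln_prod) (auto dest: prime_gt_0_nat)
    finally show ?thesis by (simp add: ln_realpow prime_gt_0_nat)
  qed
  have "real (card B) * ln w = (\<Sum>n\<in>B. ln w)" by simp
  also have "\<dots> \<le> (\<Sum>n\<in>B. ln (real (smooth_part t n)))"
    using assms by (intro sum_mono) (auto simp: B_def)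
  also have "\<dots> \<le> (\<Sum>n\<in>A. ln (real (smooth_part t n)))"
    using finA by (intro sum_mono2) (auto simp: A_def B_def Suc_le_eq)
  also have "\<dots> = (\<Sum>p | prime p \<and> p \<le> t. \<Sum>n\<in>A. real (multiplicity p n) * ln (real p))"
    unfolding ln_sp by (rule sum.swap)
  also have "\<dots> = (\<Sum>p | prime p \<and> p \<le> t. (\<Sum>n\<in>A. real (multiplicity p n)) * ln (real p))"
    by (simp add: sum_distrib_right)
  also have "\<dots> \<le> (\<Sum>p | prime p \<and> p \<le> t. (2 * x / real p) * ln (real p))"
    using assms unfolding A_def
    by (intro sum_mono mult_right_mono sum_multiplicity_le) (auto dest: prime_gt_0_nat)
  also have "\<dots> = 2 * x * (\<Sum>p | prime p \<and> p \<le> t. ln (real p) / real p)"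
    by (simp add: sum_distrib_left)
  also have "\<dots> \<le> 2 * x * (4 * ln (y / 1) + 4)"
    unfolding P using assms by (intro mult_left_mono sum_ln_over_primes_le) auto
  finally show ?thesis by (simp add: B_def t_def algebra_simps)
qed

lemma smooth_part_mono: "t \<le> t' \<Longrightarrow> smooth_part t n \<le> smooth_part t' n"
proof (rule lift_Suc_mono_le[of "\<lambda>t. smooth_part t n"])
  fix t show "smooth_part t n \<le> smooth_part (Suc t) n"
    by (simp add: smooth_part_Suc)
qed

section \<open>Primes carrying the partial product across the window from \<open>X1\<close> to
  \<open>X2\<close>\<close>

text \<open>Write \<open>n = f q r\<close> with \<open>r > q\<close> another large prime. For fixed \<open>f\<close>, the primes \<open>q\<close> lie within a factor
  \<open>X\<^sub>2 / X\<^sub>1\<close> of each other, and counting the primes \<open>r\<close> saves the logarithm lost in summing \<open>1 / f\<close>.\<close>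

lemma card_crossing_le:
  fixes x y X1 X2 :: real
  assumes "x \<ge> 1" "y \<ge> 2" "0 < X1" "X1 \<le> X2"
  defines "B \<equiv> {n. 0 < n \<and> real n \<le> x \<and> X2 < real n \<and> \<not> (\<exists>q. y < real q \<and> q\<^sup>2 dvd n) \<and>
    (\<exists>q. prime q \<and> q dvd n \<and> y < real q \<and> X1 < real (smooth_part q n) \<and> real (smooth_part q n) \<le> X2)}"
  shows "real (card B) \<le> 2 * x * (1 + ln x) * (4 * ln (X2 / X1) + 8) / (ln y)\<^sup>2"
proof -
  define L where "L = (4 * ln (X2 / X1) + 8) / ln y"
  define F where "F = {f. 0 < f \<and> real f \<le> x}"
  define Q where "Q = (\<lambda>f. {q. (prime q \<and> y < real q \<and> X1 < real (smooth_part (q - 1) f * q) \<and>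
    real (smooth_part (q - 1) f * q) \<le> X2) \<and> real q \<le> X2})"
  define R where "R = (\<lambda>f q. {r. prime r \<and> y < real r \<and> real r \<le> x / (real f * real q)})"
  have lny: "ln y > 0" using assms by simp
  have finF: "finite F" unfolding F_def by simp
  have finQ: "finite (Q f)" for f unfolding Q_def by (rule finite_nats_real_le)
  have finR: "finite (R f q)" for f q
    unfolding R_def using finite_nats_real_le[of "\<lambda>r. prime r \<and> y < real r"] by simp
  have "B \<subseteq> (\<Union>f\<in>F. \<Union>q\<in>Q f. (\<lambda>r. f * q * r) ` R f q)"
  proof
    fix n assume "n \<in> B"
    then obtain q where n: "0 < n" "real n \<le> x" "X2 < real n"
      and q: "prime q" "q dvd n" "y < real q" "\<not> q\<^sup>2 dvd n"
        "X1 < real (smooth_part q n)" "real (smooth_part q n) \<le> X2"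
      unfolding B_def by auto
    have q0: "q > 1" using q prime_gt_1_nat by auto
    obtain m where m: "n = smooth_part q n * m" "m > 0" "\<And>p. prime p \<Longrightarrow> p dvd m \<Longrightarrow> q < p"
      using smooth_part_decomp[OF n(1)] by metis
    \<comment> \<open>If m were 1, then n would equal its smooth part, which is at most
      \<open>X2\<close> < n. Thus a prime r > q exists.\<close>
    have "m \<noteq> 1" using m(1) n q by auto
    then obtain r where r: "prime r" "r dvd m" using prime_factor_nat by blast
    then obtain m' where m': "m = r * m'" by blast
    have "q < r" using m r by auto
    have "multiplicity q n = 1"
      using q by (intro multiplicity_eqI) (auto simp: numeral_2_eq_2)
    then have sq: "smooth_part q n = smooth_part (q - 1) n * q"
      using smooth_part_Suc[of "q - 1" n] q q0 by simp
    \<comment> \<open>Neither q nor r affects the part of n below q, so the window condition on q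
      can be read off from f alone.\<close>
    define f where "f = smooth_part (q - 1) n * m'"
    have nf: "n = f * q * r" using m(1) unfolding sq m' f_def by (simp add: ac_simps)
    then have f0: "f > 0" using n by (intro gr0I) auto
    have one: "smooth_part (q - 1) p = 1" if "prime p" "p \<ge> q" for p
    proof (rule smooth_part_eq_1)
      fix p' assume "prime p'" "p' dvd p"
      then have "p' = p" using that primes_dvd_imp_eq by blast
      then show "q - 1 < p'" using that q0 by simp
    qed
    have "smooth_part (q - 1) n = smooth_part (q - 1) f"
      unfolding nf using f0 q0 r prime_gt_0_nat[OF r(1)] one[of q] one[of r] q \<open>q < r\<close>
      by (simp add: smooth_part_mult)
    then have sf: "smooth_part q n = smooth_part (q - 1) f * q" using sq by simp
    have "real f * real q * real r \<le> x" using n nf by simp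
    moreover have "1 \<le> real q * real r"
      using q0 prime_gt_0_nat[OF r(1)] by (simp flip: of_nat_mult)
    ultimately have "real f \<le> x"
      using mult_left_mono[of 1 "real q * real r" "real f"] by (simp add: mult.assoc)
    then have "f \<in> F" using f0 by (simp add: F_def)
    moreover have "q \<in> Q f"
    proof -
      have "1 * q \<le> smooth_part (q - 1) f * q" by (intro mult_right_mono) (auto simp: Suc_le_eq)
      then have "real q \<le> real (smooth_part (q - 1) f * q)" by (simp only: of_nat_le_iff mult_1)
      then show ?thesis using q unfolding Q_def sf by auto
    qed
    moreover have "r \<in> R f q"
      using r q \<open>q < r\<close> f0 q0 \<open>real f * real q * real r \<le> x\<close> by (auto simp: R_def pos_le_divide_eq ac_simps)
    ultimately show "n \<in> (\<Union>f\<in>F. \<Union>q\<in>Q f. (\<lambda>r. f * q * r) ` R f q)"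
      using nf by blast
  qed
  then have "card B \<le> card (\<Union>f\<in>F. \<Union>q\<in>Q f. (\<lambda>r. f * q * r) ` R f q)"
    using finF finQ finR by (intro card_mono) auto
  also have "\<dots> \<le> (\<Sum>f\<in>F. card (\<Union>q\<in>Q f. (\<lambda>r. f * q * r) ` R f q))"
    using finF by (rule card_UN_le)
  also have "\<dots> \<le> (\<Sum>f\<in>F. \<Sum>q\<in>Q f. card ((\<lambda>r. f * q * r) ` R f q))"
    using finQ by (intro sum_mono card_UN_le)
  also have "\<dots> \<le> (\<Sum>f\<in>F. \<Sum>q\<in>Q f. card (R f q))"
    using finR by (intro sum_mono card_image_le)
  finally have "real (card B) \<le> (\<Sum>f\<in>F. \<Sum>q\<in>Q f. real (card (R f q)))"
    by (simp only: of_nat_le_iff flip: of_nat_sum)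
  \<comment> \<open>Chebyshev's bound for the primes r supplies the first of the two factors 1 / ln
    y.\<close>
  also have "\<dots> \<le> (\<Sum>f\<in>F. \<Sum>q\<in>Q f. (2 * x / (real f * ln y)) * (1 / real q))"
  proof (intro sum_mono)
    fix f q assume "f \<in> F" "q \<in> Q f"
    then have pos: "f > 0" "q > 0" by (auto simp: F_def Q_def prime_gt_0_nat)
    have "real (card (R f q)) * ln y \<le> 2 * (x / (real f * real q))"
      unfolding R_def using assms by (intro card_primes_between_le) auto
    then show "real (card (R f q)) \<le> (2 * x / (real f * ln y)) * (1 / real q)"
      using pos lny by (simp add: field_simps)
  qed
  also have "\<dots> = (\<Sum>f\<in>F. (2 * x / (real f * ln y)) * (\<Sum>q\<in>Q f. 1 / real q))"
    by (simp add: sum_distrib_left)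
  also have "\<dots> \<le> (\<Sum>f\<in>F. (2 * x / (real f * ln y)) * L)"
  proof (intro sum_mono mult_left_mono)
    fix f
    show "(\<Sum>q\<in>Q f. 1 / real q) \<le> L"
    proof (cases "Q f = {}")
      case True
      then show ?thesis using assms lny by (simp add: L_def)
    next
      case False
      \<comment> \<open>Compare with the least element: the smooth part s of f below
        \<open>q0\<close> satisfies s \<open>q0\<close> > \<open>X1\<close>, and s q <=
        \<open>X2\<close> for every other q by monotonicity, so q / \<open>q0\<close> <=
        \<open>X2\<close> / \<open>X1\<close>.\<close>
      define q0 where "q0 = Min (Q f)"
      have q0: "q0 \<in> Q f" using False finQ by (simp add: q0_def)
      then have q0pos: "q0 > 0" by (simp add: Q_def prime_gt_0_nat)
      \<comment> \<open>The Mertens range is open on the left; starting at \<open>q0\<close> / 2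
        keeps \<open>q0\<close> inside and costs only 4 ln 2, absorbed in the 8.\<close>
      have sub: "Q f \<subseteq> {q. prime q \<and> real q0 / 2 < real q \<and> real q \<le> real q0 * (X2 / X1)}"
      proof
        fix q assume q: "q \<in> Q f"
        then have le: "q0 \<le> q" using finQ by (simp add: q0_def)
        let ?s = "real (smooth_part (q0 - 1) f)"
        have s: "?s > 0" by simp
        have "smooth_part (q0 - 1) f \<le> smooth_part (q - 1) f"
          using le by (intro smooth_part_mono) auto
        then have "?s * real q \<le> real (smooth_part (q - 1) f) * real q"
          by (intro mult_right_mono) auto
        also have "\<dots> \<le> X2" using q by (simp add: Q_def)
        finally have 1: "?s * real q \<le> X2" .
        have 2: "X1 \<le> ?s * real q0" using q0 by (simp add: Q_def)
        have "(?s * real q) * X1 \<le> X2 * (?s * real q0)"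
          using 1 2 assms by (intro mult_mono) auto
        then have "?s * (real q * X1) \<le> ?s * (real q0 * X2)" by (simp add: ac_simps)
        then have "real q * X1 \<le> real q0 * X2" using s by (simp only: mult_le_cancel_left_pos)
        then show "q \<in> {q. prime q \<and> real q0 / 2 < real q \<and> real q \<le> real q0 * (X2 / X1)}"
          using q le q0pos assms by (auto simp: Q_def pos_le_divide_eq)
      qed
      \<comment> \<open>Since q > y, inserting ln q / ln y only enlarges the terms; this is the
        second factor 1 / ln y.\<close>
      have "(\<Sum>q\<in>Q f. 1 / real q) \<le> (\<Sum>q\<in>Q f. (ln (real q) / real q) / ln y)"
      proof (rule sum_mono)
        fix q assume "q \<in> Q f"
        then have "ln y \<le> ln (real q)" "q > 0" using assms by (auto simp: Q_def)
        then show "1 / real q \<le> (ln (real q) / real q) / ln y" using lny by (simp add: field_simps)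
      qed
      also have "\<dots> = (\<Sum>q\<in>Q f. ln (real q) / real q) / ln y" by (simp only: sum_divide_distrib)
      also have "\<dots> \<le> L"
        unfolding L_def
      proof (rule divide_right_mono)
        have "(\<Sum>q\<in>Q f. ln (real q) / real q) \<le>
            (\<Sum>q | prime q \<and> real q0 / 2 < real q \<and> real q \<le> real q0 * (X2 / X1). ln (real q) / real q)"
        proof (rule sum_mono2[OF _ sub])
          show "finite {q. prime q \<and> real q0 / 2 < real q \<and> real q \<le> real q0 * (X2 / X1)}"
            using finite_nats_real_le[of "\<lambda>q. prime q \<and> real q0 / 2 < real q"] by simp
        qed (auto dest: prime_gt_0_nat)
        also have "\<dots> \<le> 4 * ln (real q0 * (X2 / X1) / (real q0 / 2)) + 4"
        proof (rule sum_ln_over_primes_le)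
          have "real q0 * 1 \<le> real q0 * (X2 / X1)" using assms by (intro mult_left_mono) auto
          then show "real q0 / 2 \<le> real q0 * (X2 / X1)" by linarith
        qed (use q0pos in auto)
        also have "real q0 * (X2 / X1) / (real q0 / 2) = 2 * (X2 / X1)" using q0pos by simp
        also have "ln (2 * (X2 / X1)) = ln 2 + ln (X2 / X1)" using assms by (intro ln_mult_pos) auto
        also have "4 * (ln 2 + l) + 4 \<le> 4 * l + 8" for l :: real
          using ln_2_less_1 by simp
        finally show "(\<Sum>q\<in>Q f. ln (real q) / real q) \<le> 4 * ln (X2 / X1) + 8" .
      qed (use lny in simp)
      finally show ?thesis .
    qed
  qed (use assms lny in auto)
  also have "\<dots> = (2 * x * L / ln y) * (\<Sum>f\<in>F. 1 / real f)"
    unfolding sum_distrib_left by (intro sum.cong refl) simp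
  also have "\<dots> \<le> (2 * x * L / ln y) * (1 + ln x)"
    unfolding F_def using assms lny by (intro mult_left_mono sum_inverse_nats_le) (auto simp: L_def)
  also have "\<dots> = 2 * x * (1 + ln x) * (4 * ln (X2 / X1) + 8) / (ln y)\<^sup>2"
    by (simp add: L_def power2_eq_square field_simps)
  finally show ?thesis .
qed

text \<open>The least t whose smooth part exceeds \<open>X1\<close> is the crossing prime, and d is
  the smooth part just before it. Since t > y, it divides n once; by \<open>cross\<close> it leaps
  over the window, so d t > \<open>X2\<close>, and every prime of m is at least t.\<close>

lemma crossing_decomp:
  fixes n p0 :: nat and y X1 X2 :: real
  assumes "n > 0" "X1 < real n" "real (smooth_part (nat \<lfloor>y\<rfloor>) n) \<le> X1" "y \<ge> 1"
    and sqf: "\<not> (\<exists>q. y < real q \<and> q\<^sup>2 dvd n)"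
    and cross: "\<not> (\<exists>q. prime q \<and> q dvd n \<and> y < real q \<and> X1 < real (smooth_part q n) \<and> real (smooth_part q n) \<le> X2)"
    and p0: "prime p0" "p0 dvd n" "real p0 \<le> y"
  obtains d m where "n = d * m" "coprime d m" "real d \<le> X1" "p0 dvd d"
    "\<And>p. prime p \<Longrightarrow> p dvd m \<Longrightarrow> X2 < real p * real d"
proof -
  define t where "t = (LEAST t. X1 < real (smooth_part t n))"
  have "X1 < real (smooth_part n n)" using assms by (simp add: smooth_part_full)
  then have t: "X1 < real (smooth_part t n)" unfolding t_def by (rule LeastI)
  have "\<not> t \<le> nat \<lfloor>y\<rfloor>"
  proof
    assume "t \<le> nat \<lfloor>y\<rfloor>"
    then have "smooth_part t n \<le> smooth_part (nat \<lfloor>y\<rfloor>) n" by (rule smooth_part_mono)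
    then show False using t assms by linarith
  qed
  then have yt: "y < real t" by linarith
  then obtain u where u: "t = Suc u" using assms by (cases t) auto
  have d: "real (smooth_part u n) \<le> X1"
    using not_less_Least[of u "\<lambda>t. X1 < real (smooth_part t n)"] by (auto simp: u t_def[symmetric])
  \<comment> \<open>The smooth part can only change at a prime that divides n.\<close>
  have pt: "prime t" using t d by (auto simp: u smooth_part_Suc split: if_splits)
  have "multiplicity t n \<noteq> 0"
  proof
    assume "multiplicity t n = 0"
    then have "smooth_part t n = smooth_part u n" by (simp add: u smooth_part_Suc)
    then show False using t d by simp
  qed
  then have tn: "t dvd n" by (rule contrapos_np) (simp add: not_dvd_imp_multiplicity_0)
  moreover have "\<not> t\<^sup>2 dvd n" using sqf yt by blast
  ultimately have "multiplicity t n = 1"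
    by (intro multiplicity_eqI) (auto simp: numeral_2_eq_2)
  then have "smooth_part t n = smooth_part u n * t" using pt by (simp add: u smooth_part_Suc)
  moreover have "X2 < real (smooth_part t n)" using cross pt tn yt t not_le by blast
  ultimately have X2: "X2 < real (smooth_part u n) * real t" by simp
  obtain m where m: "n = smooth_part u n * m" "coprime (smooth_part u n) m"
      "\<And>p. prime p \<Longrightarrow> p dvd m \<Longrightarrow> u < p"
    using smooth_part_decomp[OF assms(1)] by metis
  show ?thesis
  proof (rule that[OF m(1) m(2) d])
    \<comment> \<open>From p0 <= y < t = \<open>Suc u\<close> follows p0 <= u, so this prime stays
      in d.\<close>
    have "real p0 < real (Suc u)" using p0 yt u by linarith
    then show "p0 dvd smooth_part u n" using p0 assms by (simp add: prime_dvd_smooth_part_iff)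
    fix p assume "prime p" "p dvd m"
    then have "t \<le> p" using m(3) u by (simp add: Suc_le_eq)
    then have "real (smooth_part u n) * real t \<le> real (smooth_part u n) * real p"
      by (intro mult_left_mono) auto
    then show "X2 < real p * real (smooth_part u n)" using X2 by (simp only: mult.commute[of "real p"])
  qed
qed

section \<open>Fibers of the sum of proper divisors\<close>

text \<open>Coprimality makes (d, e) -> d e a bijection from pairs of divisors to divisors of the
  product.\<close>

lemma divisor_sigma_coprime_mult:
  assumes "coprime a b" "a > 0" "b > 0"
  shows "divisor_sigma (a * b) = divisor_sigma a * divisor_sigma b"
proof -
  have inj: "inj_on (\<lambda>(d, e). d * e) ({d. d dvd a} \<times> {e. e dvd b})"
  proof (rule inj_onI, clarsimp)
    fix d e d' e' assume h: "d dvd a" "e dvd b" "d' dvd a" "e' dvd b" "d * e = d' * e'"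
    have "coprime d e'" "coprime d' e" using h assms by (meson coprime_divisors)+
    then have "d dvd d'" "d' dvd d"
      using h(5) by (metis coprime_dvd_mult_left_iff dvd_triv_left)+
    then have "d = d'" by (rule dvd_antisym)
    moreover have "d > 0" using h assms by (auto intro: gr0I)
    ultimately show "d = d' \<and> e = e'" using h(5) by simp
  qed
  have img: "(\<lambda>(d, e). d * e) ` ({d. d dvd a} \<times> {e. e dvd b}) = {d. d dvd a * b}"
  proof safe
    fix d assume "d dvd a * b"
    then obtain b' c' where "d = b' * c'" "b' dvd a" "c' dvd b"
      using division_decomp[of d a b] by auto
    then show "d \<in> (\<lambda>(d, e). d * e) ` ({d. d dvd a} \<times> {e. e dvd b})"
      by (intro image_eqI[of _ _ "(b', c')"]) auto
  qed (auto intro: mult_dvd_mono)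
  have "divisor_sigma (a * b) = (\<Sum>(d, e)\<in>{d. d dvd a} \<times> {e. e dvd b}. d * e)"
    unfolding divisor_sigma_def img[symmetric] by (subst sum.reindex[OF inj]) (simp add: case_prod_unfold)
  also have "\<dots> = divisor_sigma a * divisor_sigma b"
    unfolding divisor_sigma_def by (simp add: sum_product sum.cartesian_product)
  finally show ?thesis .
qed

lemma divisor_sigma_eq_aliquot_sum: "n > 0 \<Longrightarrow> divisor_sigma n = aliquot_sum n + n"
proof -
  assume "n > 0"
  then have "n \<le> divisor_sigma n"
    unfolding divisor_sigma_def by (intro member_le_sum) auto
  then show ?thesis by (simp add: aliquot_sum_def)
qed

lemma divisor_sigma_le:
  assumes "n > 0"
  shows "divisor_sigma n \<le> card {d. d dvd n} * n"
proof -
  have "(\<Sum>d | d dvd n. d) \<le> of_nat (card {d. d dvd n}) * n"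
    using assms by (intro sum_bounded_above) (auto dest: dvd_imp_le)
  then show ?thesis by (simp add: divisor_sigma_def)
qed

text \<open>Expand (s(d) + d)(s(m) + m) and cancel d m. The result is linear in m up to a term that
  is small when s(m) is.\<close>

lemma aliquot_sum_coprime_mult:
  assumes "coprime d m" "d > 0" "m > 0"
  shows "aliquot_sum (d * m) = aliquot_sum d * m + divisor_sigma d * aliquot_sum m"
proof -
  have "aliquot_sum (d * m) + d * m = (aliquot_sum d + d) * (aliquot_sum m + m)"
    using divisor_sigma_coprime_mult[OF assms] assms
      divisor_sigma_eq_aliquot_sum[of "d * m"] divisor_sigma_eq_aliquot_sum[of d]
      divisor_sigma_eq_aliquot_sum[of m] by simp
  then show ?thesis using divisor_sigma_eq_aliquot_sum[of d] assms by (simp add: algebra_simps)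
qed

text \<open>The complement of a proper divisor has a prime factor, which exceeds \<open>P\<close>;
  so each proper divisor is at most m / \<open>P\<close>.\<close>

lemma aliquot_sum_le_rough:
  fixes P :: real
  assumes "m > 0" "P > 0" "\<And>p. prime p \<Longrightarrow> p dvd m \<Longrightarrow> P < real p"
  shows "real (aliquot_sum m) \<le> real (card {d. d dvd m}) * (real m / P)"
proof -
  have "real (aliquot_sum m) = (\<Sum>e | e dvd m \<and> e < m. real e)"
    using assms by (simp add: aliquot_sum_eq)
  also have "\<dots> \<le> (\<Sum>e | e dvd m \<and> e < m. real m / P)"
  proof (rule sum_mono)
    fix e assume "e \<in> {e. e dvd m \<and> e < m}"
    then obtain c where c: "m = e * c" "e < m" by auto
    then have "c \<noteq> 1" by auto
    then obtain p where p: "prime p" "p dvd c" using prime_factor_nat by blast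
    have "c > 0" using c assms by (intro gr0I) auto
    then have "p \<le> c" using p by (intro dvd_imp_le) auto
    moreover have "P < real p" using p c assms by auto
    ultimately have "P \<le> real c" by linarith
    then have "real e * P \<le> real e * real c" by (intro mult_left_mono) auto
    then show "real e \<le> real m / P" using assms c by (simp add: pos_le_divide_eq)
  qed
  also have "\<dots> = real (card {e. e dvd m \<and> e < m}) * (real m / P)" by simp
  also have "\<dots> \<le> real (card {d. d dvd m}) * (real m / P)"
    using assms by (intro mult_right_mono) (auto intro!: card_mono)
  finally show ?thesis .
qed

text \<open>d / p is a proper divisor. With p bounded, dividing by s(d) is then nearly as good as
  dividing by d.\<close>

lemma aliquot_sum_ge_prime:
  assumes "d > 0" "prime p" "p dvd d"
  shows "d \<le> p * aliquot_sum d"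
proof -
  obtain c where c: "d = p * c" using assms by blast
  have "c > 0" using c assms by (intro gr0I) auto
  then have "1 * c < p * c"
    using prime_gt_1_nat[OF assms(2)] by (intro mult_strict_right_mono) auto
  then have "c < d" using c by simp
  then have "c \<in> {e. e dvd d \<and> e < d}" using c by auto
  then have "c \<le> (\<Sum>e | e dvd d \<and> e < d. e)" by (intro member_le_sum) auto
  then have "c \<le> aliquot_sum d" using assms by (simp add: aliquot_sum_eq)
  then show ?thesis using c by simp
qed

text \<open>Measured from the least element, all elements are multiples of k no larger than
  \<open>W\<close>.\<close>

lemma card_progression_le:
  fixes M :: "nat set" and W :: real
  assumes "finite M" "k > 0" "W \<ge> 0"
    and cong: "\<And>m m'. m \<in> M \<Longrightarrow> m' \<in> M \<Longrightarrow> m \<le> m' \<Longrightarrow> k dvd m' - m"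
    and close: "\<And>m m'. m \<in> M \<Longrightarrow> m' \<in> M \<Longrightarrow> real m' \<le> real m + W"
  shows "real (card M) \<le> 1 + W / real k"
proof (cases "M = {}")
  case False
  define m0 where "m0 = Min M"
  have m0: "m0 \<in> M" using assms False by (simp add: m0_def)
  have "M \<subseteq> (\<lambda>j. m0 + k * j) ` {..nat \<lfloor>W / k\<rfloor>}"
  proof
    fix m assume m: "m \<in> M"
    then have le: "m0 \<le> m" using assms by (simp add: m0_def)
    then obtain j where j: "m - m0 = k * j" using cong[OF m0 m] by blast
    then have mj: "m = m0 + k * j" using le by simp
    have "real k * real j \<le> W" using close[OF m0 m] mj by simp
    then have "real j \<le> W / k" using assms by (simp add: field_simps)
    then show "m \<in> (\<lambda>j. m0 + k * j) ` {..nat \<lfloor>W / k\<rfloor>}" using mj by (auto simp: le_nat_floor)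
  qed
  then have "card M \<le> card ((\<lambda>j. m0 + k * j) ` {..nat \<lfloor>W / k\<rfloor>})" by (intro card_mono) auto
  also have "\<dots> \<le> nat \<lfloor>W / k\<rfloor> + 1" using card_image_le[of "{..nat \<lfloor>W / k\<rfloor>}"] by auto
  finally have "real (card M) \<le> real (nat \<lfloor>W / k\<rfloor> + 1)" by (simp only: of_nat_le_iff)
  also have "\<dots> \<le> 1 + W / k" using assms by simp
  finally show ?thesis .
next
  case True
  then show ?thesis using assms(3) by simp
qed

text \<open>For fixed \<open>d\<close>, the equation \<open>s(dm) = s(d) m + \<sigma>(d) s(m)\<close> confines \<open>m\<close> to a short interval because
  \<open>s(m)\<close> is small, and \<open>\<sigma>(d) \<sigma>(m) = s(dm) + dm\<close> confines \<open>m\<close> to a residue class.\<close>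

lemma card_cofactors_le:
  fixes x X2 T z :: real and a d :: nat
  assumes "x \<ge> 0" "X2 > 0" "T \<ge> 0" "d > 0"
    and T: "\<And>k. 0 < k \<Longrightarrow> real k \<le> x \<Longrightarrow> real (card {e. e dvd k}) \<le> T"
    and p0: "prime p0" "p0 dvd d" "real p0 \<le> z"
  defines "M \<equiv> {m. 0 < m \<and> real (d * m) \<le> x \<and> coprime d m \<and> aliquot_sum (d * m) = a \<and>
    (\<forall>p. prime p \<and> p dvd m \<longrightarrow> X2 < real p * real d)}"
  shows "real (card M) \<le> 1 + z * T\<^sup>2 * (x / X2) *
    (if gcd d (divisor_sigma d) dvd a then real (gcd d (divisor_sigma d)) / real d else 0)"
proof (cases "M = {}")
  case False
  define g where "g = gcd d (divisor_sigma d)"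
  \<comment> \<open>Cancelling g from d m = -a modulo \<sigma>(d) leaves d / g invertible modulo k,
    so k is the modulus of the progression; \<open>W\<close> is the length of the interval for
    m.\<close>
  define k where "k = divisor_sigma d div g"
  define W where "W = z * T\<^sup>2 * (x / X2)"
  have z: "z \<ge> 0" using p0 by linarith
  have W: "W \<ge> 0" using assms z by (simp add: W_def)
  have sd: "divisor_sigma d = aliquot_sum d + d" using assms by (simp add: divisor_sigma_eq_aliquot_sum)
  have g: "g > 0" "g dvd d" "g dvd divisor_sigma d" using assms by (auto simp: g_def)
  then have k: "divisor_sigma d = g * k" "k > 0" using sd assms by (auto simp: k_def intro: gr0I)
  have M: "m > 0" "real d * real m \<le> x" "real d \<le> x" "real m \<le> x" if "m \<in> M" for m
  proof -
    show m: "m > 0" "real d * real m \<le> x" using that by (auto simp: M_def)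
    have "real d * 1 \<le> real d * real m" "1 * real m \<le> real d * real m"
      using m assms by (auto intro!: mult_left_mono mult_right_mono simp: Suc_le_eq)
    then show "real d \<le> x" "real m \<le> x" using m by linarith+
  qed
  have eq: "a = aliquot_sum d * m + divisor_sigma d * aliquot_sum m" if "m \<in> M" for m
    using that aliquot_sum_coprime_mult[of d m] assms(4) by (auto simp: M_def)
  have eq': "a + d * m = divisor_sigma d * divisor_sigma m" if "m \<in> M" for m
    using eq[OF that] divisor_sigma_eq_aliquot_sum[OF M(1)[OF that]] by (simp add: sd algebra_simps)
  \<comment> \<open>g divides both d and \<sigma>(d), so one solution m already forces g to divide
    a. This explains the conditional in the bound.\<close>
  have ga: "g dvd a"
  proof -
    obtain m where "m \<in> M" using False by blast
    then have "g dvd a + d * m" using eq' g by auto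
    then show ?thesis using g by (metis dvd_add_left_iff dvd_mult2)
  qed
  have finM: "finite M"
    using finite_subset[OF _ finite_nats_real_le[of "\<lambda>_. True" x]] M(4) by blast
  have sdpos: "aliquot_sum d > 0" using aliquot_sum_ge_prime[OF assms(4) p0(1,2)] assms(4) by (auto intro: gr0I)
  \<comment> \<open>The error \<sigma>(d) s(m) is at most (T d)(T x / \<open>X2\<close>), and d <= z
    s(d) through the small prime p0. Dividing by s(d) leaves \<open>W\<close>.\<close>
  have err: "0 \<le> real a - real (aliquot_sum d) * real m"
    "real a - real (aliquot_sum d) * real m \<le> real (aliquot_sum d) * W" if "m \<in> M" for m
  proof -
    have diff: "real a - real (aliquot_sum d) * real m = real (divisor_sigma d) * real (aliquot_sum m)"
      by (subst eq[OF that]) simp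
    then show "0 \<le> real a - real (aliquot_sum d) * real m" by simp
    have "real (divisor_sigma d) \<le> real (card {e. e dvd d} * d)"
      using divisor_sigma_le[OF assms(4)] by (simp only: of_nat_le_iff)
    also have "\<dots> \<le> T * real d" using T[OF assms(4) M(3)[OF that]] by (simp add: mult_right_mono)
    finally have 1: "real (divisor_sigma d) \<le> T * real d" .
    have "X2 / real d < real p" if "prime p" "p dvd m" for p
      using that \<open>m \<in> M\<close> assms(4) by (auto simp: M_def pos_divide_less_eq)
    then have "real (aliquot_sum m) \<le> real (card {e. e dvd m}) * (real m / (X2 / real d))"
      using M(1)[OF that] assms(2,4) by (intro aliquot_sum_le_rough) auto
    also have "\<dots> \<le> T * (real m / (X2 / real d))"
      using T[OF M(1)[OF that] M(4)[OF that]] assms(2) by (intro mult_right_mono) auto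
    also have "\<dots> = T * ((real d * real m) / X2)" by simp
    also have "\<dots> \<le> T * (x / X2)"
      using M(2)[OF that] assms(2,3) by (intro mult_left_mono divide_right_mono) auto
    finally have 2: "real (aliquot_sum m) \<le> T * (x / X2)" .
    have "real d \<le> real (p0 * aliquot_sum d)"
      using aliquot_sum_ge_prime[OF assms(4) p0(1,2)] by (simp only: of_nat_le_iff)
    also have "\<dots> \<le> z * real (aliquot_sum d)" using p0(3) by (simp add: mult_right_mono)
    finally have 3: "real d \<le> z * real (aliquot_sum d)" .
    have "real (divisor_sigma d) * real (aliquot_sum m) \<le> (T * real d) * (T * (x / X2))"
      using 1 2 assms(3) by (intro mult_mono) auto
    also have "\<dots> \<le> (T * (z * real (aliquot_sum d))) * (T * (x / X2))"
      using 3 assms(1-3) by (intro mult_right_mono mult_left_mono) auto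
    also have "\<dots> = real (aliquot_sum d) * W" by (simp add: W_def power2_eq_square ac_simps)
    finally show "real a - real (aliquot_sum d) * real m \<le> real (aliquot_sum d) * W" using diff by simp
  qed
  have "real (card M) \<le> 1 + W / real k"
  proof (rule card_progression_le[OF finM k(2) W])
    fix m m' assume m: "m \<in> M" "m' \<in> M"
    show "real m' \<le> real m + W"
    proof -
      have "real (aliquot_sum d) * real m' \<le> real (aliquot_sum d) * (real m + W)"
        using err[OF m(1)] err[OF m(2)] by (simp add: distrib_left)
      then show ?thesis using sdpos by simp
    qed
    assume le: "m \<le> m'"
    obtain d' where d': "d = g * d'" using g by blast
    have cop: "coprime k d'"
    proof -
      have "gcd d (divisor_sigma d) = g * gcd d' k" by (subst d', subst k(1)) (simp add: gcd_mult_distrib_nat)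
      then have "gcd d' k = 1" using g(1) by (simp add: g_def[symmetric])
      then show ?thesis by (simp add: coprime_iff_gcd_eq_1 gcd.commute)
    qed
    have "g * k dvd a + d * m" "g * k dvd a + d * m'" using eq'[OF m(1)] eq'[OF m(2)] k(1) by auto
    then have "g * k dvd (a + d * m') - (a + d * m)" by (rule dvd_diff_nat[rotated])
    also have "(a + d * m') - (a + d * m) = g * (d' * (m' - m))"
      by (simp add: d' right_diff_distrib' ac_simps)
    finally have "k dvd d' * (m' - m)" using g(1) by simp
    then show "k dvd m' - m" using cop by (simp add: coprime_dvd_mult_right_iff)
  qed
  also have "\<dots> \<le> 1 + W * (real g / real d)"
  proof -
    \<comment> \<open>\<sigma>(d) >= d means k >= d / g.\<close>
    have "real d \<le> real (g * k)" using sd k(1) by simp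
    then have "1 / real k \<le> real g / real d" using k(2) assms(4) by (simp add: field_simps)
    then have "W * (1 / real k) \<le> W * (real g / real d)" using W by (rule mult_left_mono)
    then show ?thesis by simp
  qed
  finally show ?thesis using ga by (simp add: g_def W_def)
next
  case True
  have "z \<ge> 0" using p0 by linarith
  then show ?thesis unfolding True using assms(1-3) by simp
qed

text \<open>Only divisors \<open>g\<close> of \<open>a\<close> occur as \<open>gcd(d, \<sigma>(d))\<close>, which makes the sum of \<open>g / d\<close> harmless.\<close>

lemma card_fiber_le:
  fixes x X1 X2 T z :: real and a :: nat
  assumes "x \<ge> 1" "X2 > 0" "0 \<le> X1" "X1 \<le> x" "T \<ge> 0" "a > 0" "z \<ge> 0"
    and T: "\<And>k. 0 < k \<Longrightarrow> real k \<le> x\<^sup>2 \<Longrightarrow> real (card {e. e dvd k}) \<le> T"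
  defines "F \<equiv> {n. 0 < n \<and> real n \<le> x \<and> aliquot_sum n = a \<and> (\<exists>d m. n = d * m \<and> coprime d m \<and> real d \<le> X1 \<and>
    (\<exists>p. prime p \<and> p dvd d \<and> real p \<le> z) \<and> (\<forall>p. prime p \<and> p dvd m \<longrightarrow> X2 < real p * real d))}"
  shows "real (card F) \<le> X1 + z * T ^ 3 * (x / X2) * (1 + ln x)"
proof (cases "F = {}")
  case True
  show ?thesis unfolding True using assms(1-7) by simp
next
  case False
  define W where "W = z * T\<^sup>2 * (x / X2)"
  define D where "D = {d. (0 < d \<and> (\<exists>p. prime p \<and> p dvd d \<and> real p \<le> z)) \<and> real d \<le> X1}"
  define M where "M = (\<lambda>d. {m. 0 < m \<and> real (d * m) \<le> x \<and> coprime d m \<and> aliquot_sum (d * m) = a \<and>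
    (\<forall>p. prime p \<and> p dvd m \<longrightarrow> X2 < real p * real d)})"
  have W: "W \<ge> 0" using assms(1-7) by (simp add: W_def)
  have xx: "x \<le> x\<^sup>2" using assms(1-7) by (simp add: power2_eq_square)
  have finD: "finite D" unfolding D_def by (rule finite_nats_real_le)
  have finM: "finite (M d)" if "d \<in> D" for d
  proof (rule finite_subset)
    show "M d \<subseteq> {m. True \<and> real m \<le> x}"
    proof safe
      fix m assume m: "m \<in> M d"
      have "1 * real m \<le> real d * real m" using that by (intro mult_right_mono) (auto simp: D_def Suc_le_eq)
      also have "\<dots> \<le> x" using m by (simp add: M_def)
      finally show "real m \<le> x" by simp
    qed
  qed (rule finite_nats_real_le)
  \<comment> \<open>s(n) <= n^2 for n <= x, so the divisor bound \<open>T\<close>, assumed up to the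
    square of x, also applies to a itself.\<close>
  have ax: "real a \<le> x\<^sup>2"
  proof -
    obtain n where n: "0 < n" "real n \<le> x" "aliquot_sum n = a" using False by (auto simp: F_def)
    have "card {d. d dvd n} \<le> card {1..n}" using n by (intro card_mono) (auto dest: dvd_imp_le intro: gr0I simp: Suc_le_eq)
    then have "divisor_sigma n \<le> n * n"
      using divisor_sigma_le[OF n(1)] by (simp add: order_trans[OF _ mult_right_mono])
    then have "a \<le> n * n" using n divisor_sigma_eq_aliquot_sum[of n] by simp
    then have "real a \<le> real n * real n" by (simp only: of_nat_le_iff flip: of_nat_mult)
    also have "\<dots> \<le> x * x" using n assms(1) by (intro mult_mono) auto
    finally show ?thesis by (simp add: power2_eq_square)
  qed
  have "F \<subseteq> (\<Union>d\<in>D. (\<lambda>m. d * m) ` M d)"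
  proof
    fix n assume "n \<in> F"
    then obtain d m where h: "0 < n" "real n \<le> x" "aliquot_sum n = a" "n = d * m" "coprime d m" "real d \<le> X1"
        "\<exists>p. prime p \<and> p dvd d \<and> real p \<le> z" "\<forall>p. prime p \<and> p dvd m \<longrightarrow> X2 < real p * real d"
      unfolding F_def by blast
    then have "d \<in> D" "m \<in> M d" by (auto simp: D_def M_def)
    then show "n \<in> (\<Union>d\<in>D. (\<lambda>m. d * m) ` M d)" using h(4) by blast
  qed
  then have "card F \<le> card (\<Union>d\<in>D. (\<lambda>m. d * m) ` M d)"
    using finD finM by (intro card_mono) auto
  also have "\<dots> \<le> (\<Sum>d\<in>D. card ((\<lambda>m. d * m) ` M d))"
    using finD by (rule card_UN_le)
  also have "\<dots> \<le> (\<Sum>d\<in>D. card (M d))"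
    using finM by (intro sum_mono card_image_le)
  finally have "real (card F) \<le> (\<Sum>d\<in>D. real (card (M d)))"
    by (simp only: of_nat_le_iff flip: of_nat_sum)
  \<comment> \<open>The gcd is replaced by a sum over all g dividing both a and d; it is one of
    these g, and afterwards the sums over d and g can be exchanged.\<close>
  also have "\<dots> \<le> (\<Sum>d\<in>D. 1 + W * (\<Sum>g | g dvd a. if g dvd d then real g / real d else 0))"
  proof (rule sum_mono)
    fix d assume "d \<in> D"
    then obtain p where d: "0 < d" "prime p" "p dvd d" "real p \<le> z" by (auto simp: D_def)
    let ?g = "gcd d (divisor_sigma d)"
    have "real (card (M d)) \<le> 1 + W * (if ?g dvd a then real ?g / real d else 0)"
      unfolding M_def W_def
      using assms(1-6) d xx by (intro card_cofactors_le[of _ _ _ _ p] T) auto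
    also have "(if ?g dvd a then real ?g / real d else 0) \<le> (\<Sum>g | g dvd a. if g dvd d then real g / real d else 0)"
    proof (cases "?g dvd a")
      case True
      then have "(\<Sum>g\<in>{?g}. if g dvd d then real g / real d else 0) \<le>
          (\<Sum>g | g dvd a. if g dvd d then real g / real d else 0)"
        using assms(6) by (intro sum_mono2) auto
      then show ?thesis using True by simp
    qed (auto intro: sum_nonneg)
    finally show "real (card (M d)) \<le> 1 + W * (\<Sum>g | g dvd a. if g dvd d then real g / real d else 0)"
      using W by (simp add: mult_left_mono)
  qed
  also have "\<dots> = real (card D) + W * (\<Sum>d\<in>D. \<Sum>g | g dvd a. if g dvd d then real g / real d else 0)"
    by (simp add: sum.distrib sum_distrib_left)
  also have "(\<Sum>d\<in>D. \<Sum>g | g dvd a. if g dvd d then real g / real d else 0) =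
      (\<Sum>g | g dvd a. \<Sum>d\<in>D. if g dvd d then real g / real d else 0)"
    by (rule sum.swap)
  also have "real (card D) + W * \<dots> \<le> X1 + W * (T * (1 + ln x))"
  proof (intro add_mono mult_left_mono W)
    have "card D \<le> card {1..nat \<lfloor>X1\<rfloor>}"
      by (intro card_mono) (auto simp: D_def le_nat_floor)
    then have "real (card D) \<le> real (nat \<lfloor>X1\<rfloor>)" by simp
    then show "real (card D) \<le> X1" using assms(3) by linarith
    have "(\<Sum>d\<in>D. if g dvd d then real g / real d else 0) \<le> 1 + ln x" if "g dvd a" for g
    proof -
      have g: "g > 0" using that assms(6) by (auto intro: gr0I)
      define K where "K = {k. 0 < k \<and> real k \<le> x}"
      have finK: "finite K" unfolding K_def by simp
      \<comment> \<open>Writing d = g k turns g / d into 1 / k, so each g costs only a harmonic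
        sum.\<close>
      have sub: "D \<inter> {d. g dvd d} \<subseteq> (\<lambda>k. g * k) ` K"
      proof
        fix d assume "d \<in> D \<inter> {d. g dvd d}"
        then obtain k where k: "d = g * k" "d > 0" "real d \<le> X1" by (auto simp: D_def)
        then have "k > 0" by (auto intro: gr0I)
        have "1 * real k \<le> real g * real k" using g by (intro mult_right_mono) (auto simp: Suc_le_eq)
        also have "\<dots> \<le> x" using k assms(4) by simp
        finally have "real k \<le> x" by simp
        then show "d \<in> (\<lambda>k. g * k) ` K" using k \<open>k > 0\<close> by (auto simp: K_def)
      qed
      have "(\<Sum>d\<in>D. if g dvd d then real g / real d else 0) = (\<Sum>d\<in>D \<inter> {d. g dvd d}. real g / real d)"
        using finD by (simp add: sum.If_cases)
      also have "\<dots> \<le> (\<Sum>d\<in>(\<lambda>k. g * k) ` K. real g / real d)"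
        using sub finK by (intro sum_mono2) auto
      also have "\<dots> = (\<Sum>k\<in>K. 1 / real k)"
        using g by (subst sum.reindex) (auto intro!: inj_onI)
      also have "\<dots> \<le> 1 + ln x" unfolding K_def using assms(1) by (rule sum_inverse_nats_le)
      finally show ?thesis .
    qed
    then have "(\<Sum>g | g dvd a. \<Sum>d\<in>D. if g dvd d then real g / real d else 0) \<le> (\<Sum>g | g dvd a. 1 + ln x)"
      by (intro sum_mono) auto
    also have "\<dots> = real (card {g. g dvd a}) * (1 + ln x)" by simp
    also have "\<dots> \<le> T * (1 + ln x)" using T[OF assms(6) ax] assms(1) by (intro mult_right_mono) auto
    finally show "(\<Sum>g | g dvd a. \<Sum>d\<in>D. if g dvd d then real g / real d else 0) \<le> T * (1 + ln x)" .
  qed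
  also have "\<dots> = X1 + z * T ^ 3 * (x / X2) * (1 + ln x)"
    by (simp add: W_def power2_eq_square power3_eq_cube ac_simps)
  finally show ?thesis .
qed

section \<open>Counting preimages\<close>

text \<open>The summands match the exceptional classes: n <= \<open>X2\<close>, a large square
  divisor, a large y-smooth part, no prime up to z, a partial product landing in the window. The
  remaining n factor by \<open>crossing_decomp\<close> and are counted fiber by fiber over
  \<open>A\<close>.\<close>

lemma card_aliquot_preimages_le:
  fixes x y X1 X2 T :: real and z :: nat
  assumes A: "finite A" "\<forall>a\<in>A. a > 0"
    and x: "x \<ge> 1" and X: "1 < X1" "X1 \<le> X2" "X1 \<le> x" and z: "2 \<le> z" "real z \<le> y" and T0: "T \<ge> 0"
    and T: "\<And>k. 0 < k \<Longrightarrow> real k \<le> x\<^sup>2 \<Longrightarrow> real (card {e. e dvd k}) \<le> T"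
  shows "real (card {n. n > 0 \<and> real n \<le> x \<and> aliquot_sum n \<in> A}) \<le>
    X2 + 2 * x / y + 8 * x * (ln y + 1) / ln X1 + (x / harm z + (z / harm z + 1) * fact z) +
    2 * x * (1 + ln x) * (4 * ln (X2 / X1) + 8) / (ln y)\<^sup>2 +
    real (card A) * (X1 + z * T ^ 3 * (x / X2) * (1 + ln x))"
proof -
  define B1 where "B1 = {n. 0 < n \<and> real n \<le> X2}"
  define B2 where "B2 = {n. 0 < n \<and> real n \<le> x \<and> (\<exists>q. y < real q \<and> q\<^sup>2 dvd n)}"
  define B3 where "B3 = {n. 0 < n \<and> real n \<le> x \<and> X1 < real (smooth_part (nat \<lfloor>y\<rfloor>) n)}"
  define B4 where "B4 = {n. rough_upto z n \<and> real n \<le> x}"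
  define B5 where "B5 = {n. 0 < n \<and> real n \<le> x \<and> X2 < real n \<and> \<not> (\<exists>q. y < real q \<and> q\<^sup>2 dvd n) \<and>
    (\<exists>q. prime q \<and> q dvd n \<and> y < real q \<and> X1 < real (smooth_part q n) \<and> real (smooth_part q n) \<le> X2)}"
  define F where "F = (\<lambda>a. {n. 0 < n \<and> real n \<le> x \<and> aliquot_sum n = a \<and>
    (\<exists>d m. n = d * m \<and> coprime d m \<and> real d \<le> X1 \<and>
    (\<exists>p. prime p \<and> p dvd d \<and> real p \<le> real z) \<and> (\<forall>p. prime p \<and> p dvd m \<longrightarrow> X2 < real p * real d))})"
  have y: "y \<ge> 2" using z by linarith
  have fin: "finite B1" "finite B4" unfolding B1_def B4_def by simp_all
  have finx: "finite {n. 0 < n \<and> real n \<le> x \<and> P n}" for P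
    by (rule finite_subset[OF _ finite_nats_real_le[of "\<lambda>_. True" x]]) auto
  have fin': "finite B2" "finite B3" "finite B5" "finite (F a)" for a
    unfolding B2_def B3_def B5_def F_def by (rule finx)+
  have "{n. n > 0 \<and> real n \<le> x \<and> aliquot_sum n \<in> A} \<subseteq> B1 \<union> B2 \<union> B3 \<union> B4 \<union> B5 \<union> (\<Union>a\<in>A. F a)"
  proof
    fix n assume "n \<in> {n. n > 0 \<and> real n \<le> x \<and> aliquot_sum n \<in> A}"
    then have n: "n > 0" "real n \<le> x" "aliquot_sum n \<in> A" by auto
    show "n \<in> B1 \<union> B2 \<union> B3 \<union> B4 \<union> B5 \<union> (\<Union>a\<in>A. F a)"
    proof (rule ccontr)
      assume not: "n \<notin> B1 \<union> B2 \<union> B3 \<union> B4 \<union> B5 \<union> (\<Union>a\<in>A. F a)"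
      have 1: "X2 < real n" using not n by (auto simp: B1_def)
      have 2: "\<not> (\<exists>q. y < real q \<and> q\<^sup>2 dvd n)" using not n unfolding B2_def by blast
      have 3: "real (smooth_part (nat \<lfloor>y\<rfloor>) n) \<le> X1" using not n by (auto simp: B3_def)
      obtain p where p: "prime p" "p dvd n" "p \<le> z" using not n by (auto simp: B4_def rough_upto_def)
      have 5: "\<not> (\<exists>q. prime q \<and> q dvd n \<and> y < real q \<and> X1 < real (smooth_part q n) \<and> real (smooth_part q n) \<le> X2)"
        using not n 1 2 unfolding B5_def by blast
      have X1n: "X1 < real n" and y1: "1 \<le> y" and py: "real p \<le> y" using 1 X y p z by linarith+
      obtain d m where dm: "n = d * m" "coprime d m" "real d \<le> X1" "p dvd d"
        "\<And>p. prime p \<Longrightarrow> p dvd m \<Longrightarrow> X2 < real p * real d"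
        using crossing_decomp[OF n(1) X1n 3 y1 2 5 p(1,2) py] by metis
      have "real p \<le> real z" using p by simp
      then have "n \<in> F (aliquot_sum n)" using n dm p(1) unfolding F_def by blast
      then show False using not n by blast
    qed
  qed
  then have "card {n. n > 0 \<and> real n \<le> x \<and> aliquot_sum n \<in> A} \<le> card (B1 \<union> B2 \<union> B3 \<union> B4 \<union> B5 \<union> (\<Union>a\<in>A. F a))"
    using fin fin' A by (intro card_mono) auto
  also have "\<dots> \<le> card B1 + card B2 + card B3 + card B4 + card B5 + card (\<Union>a\<in>A. F a)"
    by (intro order_trans[OF card_Un_le] add_right_mono order_refl)
  also have "card (\<Union>a\<in>A. F a) \<le> (\<Sum>a\<in>A. card (F a))" using A by (intro card_UN_le)
  finally have "real (card {n. n > 0 \<and> real n \<le> x \<and> aliquot_sum n \<in> A}) \<le>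
      real (card B1 + card B2 + card B3 + card B4 + card B5 + (\<Sum>a\<in>A. card (F a)))"
    by (simp only: of_nat_le_iff)
  also have "\<dots> = real (card B1) + real (card B2) + real (card B3) + real (card B4) + real (card B5) +
      (\<Sum>a\<in>A. real (card (F a)))"
    by simp
  also have "\<dots> \<le> X2 + 2 * x / y + 8 * x * (ln y + 1) / ln X1 + (x / harm z + (z / harm z + 1) * fact z) +
      2 * x * (1 + ln x) * (4 * ln (X2 / X1) + 8) / (ln y)\<^sup>2 +
      (\<Sum>a\<in>A. X1 + z * T ^ 3 * (x / X2) * (1 + ln x))"
  proof (intro add_mono sum_mono)
    have "card B1 \<le> card {1..nat \<lfloor>X2\<rfloor>}"
      by (intro card_mono) (auto simp: B1_def le_nat_floor)
    then have "real (card B1) \<le> real (nat \<lfloor>X2\<rfloor>)" by simp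
    then show "real (card B1) \<le> X2" using X by linarith
    show "real (card B2) \<le> 2 * x / y"
      unfolding B2_def using x y by (intro card_large_square_divisor_le) auto
    have "real (card B3) * ln X1 \<le> 8 * x * (ln y + 1)"
      unfolding B3_def using x y X by (intro card_large_smooth_part_le) auto
    then show "real (card B3) \<le> 8 * x * (ln y + 1) / ln X1"
      using X by (simp add: pos_le_divide_eq)
    show "real (card B4) \<le> x / harm z + (z / harm z + 1) * fact z"
      unfolding B4_def using x z by (intro card_rough_upto_le) auto
    show "real (card B5) \<le> 2 * x * (1 + ln x) * (4 * ln (X2 / X1) + 8) / (ln y)\<^sup>2"
      unfolding B5_def using x y X by (intro card_crossing_le) auto
    fix a assume "a \<in> A"
    then have a: "a > 0" using A by auto
    have "0 < X2" "0 \<le> X1" "0 \<le> real z" using X by auto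
    then show "real (card (F a)) \<le> X1 + z * T ^ 3 * (x / X2) * (1 + ln x)"
      unfolding F_def by (intro card_fiber_le[OF x _ _ X(3) T0 a _ T])
  qed
  finally show ?thesis by simp
qed

section \<open>Choice of exponents and passage to the limit\<close>

theorem theorem1p2:
  fixes \<epsilon> :: "real \<Rightarrow> real"
  assumes "(\<epsilon> \<longlongrightarrow> 0) at_top"
  shows "\<forall>\<delta>::real. \<delta> > 0 \<longrightarrow>
    (\<exists>x0::real. \<forall>x::real. x \<ge> x0 \<longrightarrow>
      (\<forall>A::nat set. finite A \<longrightarrow> (\<forall>a\<in>A. a > 0) \<longrightarrow>
        real (card A) \<le> x powr (1 / 2 + \<epsilon> x) \<longrightarrow>
        real (card {n::nat. n > 0 \<and> real n \<le> x \<and> aliquot_sum n \<in> A}) \<le> \<delta> * x))"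
proof (intro allI impI)
  fix \<delta> :: real assume \<delta>: "\<delta> > 0"
  \<comment> \<open>With y = x^\<kappa>, the smooth-part term tends to at most 32 \<kappa> =
    \<delta> / 8 after division by x. Then \<eta>, half the logarithmic width of the window, is
    chosen small against the square of \<kappa> to make the crossing term at most \<delta> / 8 as
    well.\<close>
  define \<kappa> where "\<kappa> = \<delta> / 256"
  define \<eta> where "\<eta> = min (1 / 4) (\<delta> * \<kappa>\<^sup>2 / 128)"
  have \<kappa>: "\<kappa> > 0" using \<delta> by (simp add: \<kappa>_def)
  then have \<eta>: "\<eta> > 0" "\<eta> \<le> 1 / 4" "16 * \<eta> * inverse (\<kappa>\<^sup>2) \<le> \<delta> / 8"
    using \<delta> by (auto simp: \<eta>_def min_def field_simps)
  have "eventually (\<lambda>z. (harm z :: real) \<ge> 8 / \<delta>) sequentially"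
    using harm_at_top by (simp add: filterlim_at_top)
  then have "eventually (\<lambda>z. (harm z :: real) \<ge> 8 / \<delta> \<and> z \<ge> 2) sequentially"
    using eventually_ge_at_top by eventually_elim auto
  then obtain z :: nat where z: "(harm z :: real) \<ge> 8 / \<delta>" "z \<ge> 2"
    using eventually_happens'[OF sequentially_bot] by blast
  \<comment> \<open>Applied to numbers up to the square of x, the exponent \<eta> / 16 gives
    x^(\<eta> / 8). With three such factors and \<open>A\<close> of size x^(1/2 + \<eta> / 8), the
    fibers total about x^(1 - \<eta> / 2) ln x.\<close>
  obtain C where C: "C \<ge> 1" "\<And>n::nat. n > 0 \<Longrightarrow> real (card {d. d dvd n}) \<le> C * real n powr (\<eta> / 16)"
    using card_divisors_le_powr[of "\<eta> / 16"] \<eta> by auto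
  define K where "K = (z / harm z + 1) * fact z"
  \<comment> \<open>This is the bound of \<open>card_aliquot_preimages_le\<close> for these
    parameters, except for x / \<open>harm z\<close>, a fixed proportion of x that is handled by the
    choice of z.\<close>
  define E where "E = (\<lambda>x. x powr (1 / 2 + \<eta>) + 2 * x / x powr \<kappa> +
    8 * x * (\<kappa> * ln x + 1) / ((1 / 2 - \<eta>) * ln x) + K +
    2 * x * (1 + ln x) * (8 * \<eta> * ln x + 8) / (\<kappa> * ln x)\<^sup>2 +
    x powr (1 / 2 + \<eta> / 8) * (x powr (1 / 2 - \<eta>) +
      z * (C * x powr (\<eta> / 8)) ^ 3 * x powr (1 / 2 - \<eta>) * (1 + ln x)))"

  \<comment> \<open>After division by x only the smooth-part and crossing terms survive.\<close>
  have "((\<lambda>x. E x / x) \<longlongrightarrow>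
      0 + 0 + 8 * \<kappa> * inverse (1 / 2 - \<eta>) + 0 + 16 * \<eta> * inverse (\<kappa>\<^sup>2) + 0) at_top"
    unfolding E_def add_divide_distrib[of _ _ "x :: real" for x]
  proof (intro tendsto_add)
    show "((\<lambda>x. x powr (1 / 2 + \<eta>) / x) \<longlongrightarrow> 0) at_top" using \<eta>(1,2) by real_asymp
    show "((\<lambda>x. 2 * x / x powr \<kappa> / x) \<longlongrightarrow> 0) at_top" using \<kappa> by real_asymp
    show "((\<lambda>x. 8 * x * (\<kappa> * ln x + 1) / ((1 / 2 - \<eta>) * ln x) / x) \<longlongrightarrow> 8 * \<kappa> * inverse (1 / 2 - \<eta>)) at_top"
      using \<eta>(1,2) \<kappa> by real_asymp
    show "((\<lambda>x. K / x) \<longlongrightarrow> 0) at_top" by real_asymp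
    show "((\<lambda>x. 2 * x * (1 + ln x) * (8 * \<eta> * ln x + 8) / (\<kappa> * ln x)\<^sup>2 / x) \<longlongrightarrow> 16 * \<eta> * inverse (\<kappa>\<^sup>2)) at_top"
      using \<eta>(1,2) \<kappa> by real_asymp
    show "((\<lambda>x. x powr (1 / 2 + \<eta> / 8) * (x powr (1 / 2 - \<eta>) +
      z * (C * x powr (\<eta> / 8)) ^ 3 * x powr (1 / 2 - \<eta>) * (1 + ln x)) / x) \<longlongrightarrow> 0) at_top"
      using \<eta>(1,2) C(1) z(2) by real_asymp
  qed
  moreover have "0 + 0 + 8 * \<kappa> * inverse (1 / 2 - \<eta>) + 0 + 16 * \<eta> * inverse (\<kappa>\<^sup>2) + 0 < \<delta> / 2"
  proof -
    have "inverse (1 / 2 - \<eta>) \<le> inverse (1 / 4)" using \<eta> by (intro le_imp_inverse_le) auto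
    then have "8 * \<kappa> * inverse (1 / 2 - \<eta>) \<le> 8 * \<kappa> * 4" using \<kappa> by (intro mult_left_mono) auto
    also have "\<dots> = \<delta> / 8" by (simp add: \<kappa>_def)
    finally show ?thesis using \<eta>(3) \<delta> by linarith
  qed
  ultimately have "eventually (\<lambda>x. E x / x < \<delta> / 2) at_top" by (rule order_tendstoD(2))
  moreover have "eventually (\<lambda>x. \<epsilon> x < \<eta> / 8) at_top"
    using assms \<eta>(1) by (intro order_tendstoD(2)) auto
  moreover have "eventually (\<lambda>x::real. real z \<le> x powr \<kappa>) at_top" using \<kappa> by real_asymp
  moreover have "eventually (\<lambda>x::real. x > 1) at_top" by (rule eventually_gt_at_top)
  ultimately have "eventually (\<lambda>x. E x / x < \<delta> / 2 \<and> \<epsilon> x < \<eta> / 8 \<and> real z \<le> x powr \<kappa> \<and> x > 1) at_top"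
    by eventually_elim auto
  then obtain x0 where x0: "\<And>x. x \<ge> x0 \<Longrightarrow> E x / x < \<delta> / 2 \<and> \<epsilon> x < \<eta> / 8 \<and> real z \<le> x powr \<kappa> \<and> x > 1"
    unfolding eventually_at_top_linorder by blast
  show "\<exists>x0::real. \<forall>x::real. x \<ge> x0 \<longrightarrow> (\<forall>A::nat set. finite A \<longrightarrow> (\<forall>a\<in>A. a > 0) \<longrightarrow>
        real (card A) \<le> x powr (1 / 2 + \<epsilon> x) \<longrightarrow>
        real (card {n::nat. n > 0 \<and> real n \<le> x \<and> aliquot_sum n \<in> A}) \<le> \<delta> * x)"
  proof (intro exI[of _ x0] allI impI)
    fix x :: real and A :: "nat set"
    assume "x \<ge> x0" and A: "finite A" "\<forall>a\<in>A. a > 0" "real (card A) \<le> x powr (1 / 2 + \<epsilon> x)"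
    then have Ex: "E x / x < \<delta> / 2" and \<epsilon>x: "\<epsilon> x < \<eta> / 8" and zx: "real z \<le> x powr \<kappa>" and x: "x > 1"
      using x0 by auto
    define X1 where "X1 = x powr (1 / 2 - \<eta>)"
    define X2 where "X2 = x powr (1 / 2 + \<eta>)"
    define T where "T = C * x powr (\<eta> / 8)"
    have "X1 > x powr 0" unfolding X1_def using x \<eta> by (intro powr_less_mono) auto
    then have X1: "X1 > 1" using x by simp
    have X12: "X1 \<le> X2" unfolding X1_def X2_def using x \<eta> by (intro powr_mono) auto
    have "X1 \<le> x powr 1" unfolding X1_def using x \<eta> by (intro powr_mono) auto
    then have X1x: "X1 \<le> x" using x by simp
    have T0: "T \<ge> 0" using C by (simp add: T_def)
    have T: "real (card {e. e dvd k}) \<le> T" if k: "0 < k" "real k \<le> x\<^sup>2" for k :: nat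
    proof -
      have "real (card {e. e dvd k}) \<le> C * real k powr (\<eta> / 16)" using C k by simp
      also have "\<dots> \<le> C * (x\<^sup>2) powr (\<eta> / 16)"
        using C k \<eta> by (intro mult_left_mono powr_mono2) auto
      also have "x\<^sup>2 = x powr 2" using x by (simp add: powr_numeral)
      also have "(x powr 2) powr (\<eta> / 16) = x powr (\<eta> / 8)" by (simp add: powr_powr)
      finally show ?thesis by (simp add: T_def)
    qed
    have q1: "x / X2 = X1" unfolding X1_def X2_def using x powr_diff[of x 1 "1 / 2 + \<eta>"] by simp
    have "X2 / X1 = x powr (2 * \<eta>)"
      unfolding X1_def X2_def using powr_diff[of x "1 / 2 + \<eta>" "1 / 2 - \<eta>"] by simp
    then have q2: "4 * ln (X2 / X1) + 8 = 8 * \<eta> * ln x + 8" using x by (simp add: ln_powr)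
    have q3: "ln X1 = (1 / 2 - \<eta>) * ln x" "ln (x powr \<kappa>) = \<kappa> * ln x"
      using x by (simp_all add: X1_def ln_powr)
    \<comment> \<open>Only the size of \<open>A\<close> enters, so \<open>x0\<close> serves every
      \<open>A\<close> at once.\<close>
    have "real (card A) \<le> x powr (1 / 2 + \<eta> / 8)"
      using A(3) \<epsilon>x x powr_mono[of "1 / 2 + \<epsilon> x" "1 / 2 + \<eta> / 8" x] by linarith
    then have cA: "real (card A) * (X1 + z * T ^ 3 * X1 * (1 + ln x)) \<le>
        x powr (1 / 2 + \<eta> / 8) * (X1 + z * T ^ 3 * X1 * (1 + ln x))"
      using x X1 T0 by (intro mult_right_mono) auto
    have "real (card {n::nat. n > 0 \<and> real n \<le> x \<and> aliquot_sum n \<in> A}) \<le>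
        X2 + 2 * x / x powr \<kappa> + 8 * x * (ln (x powr \<kappa>) + 1) / ln X1 + (x / harm z + (z / harm z + 1) * fact z) +
        2 * x * (1 + ln x) * (4 * ln (X2 / X1) + 8) / (ln (x powr \<kappa>))\<^sup>2 +
        real (card A) * (X1 + z * T ^ 3 * (x / X2) * (1 + ln x))"
      using A x X1 X12 X1x z zx T0 T by (intro card_aliquot_preimages_le) auto
    also have "\<dots> = X2 + 2 * x / x powr \<kappa> + 8 * x * (\<kappa> * ln x + 1) / ((1 / 2 - \<eta>) * ln x) + (x / harm z + K) +
        2 * x * (1 + ln x) * (8 * \<eta> * ln x + 8) / (\<kappa> * ln x)\<^sup>2 +
        real (card A) * (X1 + z * T ^ 3 * X1 * (1 + ln x))"
      unfolding q1 q2 q3 K_def ..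
    also have "\<dots> \<le> E x + x / harm z"
      using cA unfolding E_def X1_def[symmetric] X2_def[symmetric] T_def[symmetric] by linarith
    also have "E x \<le> \<delta> / 2 * x" using Ex x by (simp add: pos_divide_less_eq)
    also have "x / harm z \<le> x / (8 / \<delta>)" using z x \<delta> by (intro divide_left_mono mult_pos_pos) auto
    also have "\<delta> / 2 * x + x / (8 / \<delta>) \<le> \<delta> * x" using x \<delta> by simp
    finally show "real (card {n::nat. n > 0 \<and> real n \<le> x \<and> aliquot_sum n \<in> A}) \<le> \<delta> * x" by simp
  qed
qed

end
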